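(* For every integer $d\ge2$, the critical parameter $p_c^{\mathbf{cp}}(d)$ of the cone percolation model with geometric radius on $\overrightarrow{\mathbb{T}}_d$ is the solution in $q$ of $$\sum_{k\ge1}(dq)^k\prod_{i=1}^{k-1}(1-q^i)=1 .$$ More explicitly, $0.266667\le p_c^{\mathbf{cp}}(2)\le 0.277206$, and for every integer $d\ge3$, $$\frac{1}{2d-\frac14}\;\le\; p_c^{\mathbf{cp}}(d)\;\le\;\frac{(7d-1)\left(1-\sqrt{1-\frac{14}{(7d-1)^2}}\right)}{2}.$$
   Context: $\mathbb{T}_d$ is the infinite homogeneous tree in which every vertex has $d+1$ neighbours, with a fixed root $\mathbf{0}$; $\overrightarrow{\mathbb{T}}_d$ is obtained by directing all edges away from the root. $d(u,v)$ is the number of edges in the path between $u$ and $v$, and $u<v$ means $u\ne v$ and $u$ lies on the path from the root to $v$. Cone percolation with parameter $p\in(0,1)$: to each vertex $v$ is attached a random variable $X_v$; the $X_v$ are i.i.d. with geometric law $\mathbb{P}(X_v\ge k)=p^k$, $k\ge0$. At time $0$ only the root is informed. At time $1$ all vertices at distance at most $X_{\mathbf 0}$ from the root become informed. At each later step, each newly informed vertex $v$ informs all non-informed vertices $v'>v$ with $d(v,v')\le X_v$. The model percolates if infinitely many vertices are eventually informed, and $p_c^{\mathbf{cp}}(d)$ is the critical value, i.e. the infimum of the $p\in(0,1)$ for which the model percolates with positive probability. Empty products equal $1$. *)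

theory Defs
  imports "HOL-Probability.Probability" "HOL-Library.Sublist"
begin

text \<open>
  Ulam--Harris coding of the homogeneous tree: the root is the empty list, and a vertex is the
  list of child indices read along the path from the root. The root has \<open>d + 1\<close> children and
  every other vertex has \<open>d\<close>, so that every vertex has \<open>d + 1\<close> neighbours
  (see \<open>card_neighbours\<close>).
\<close>

definition tree_verts :: "nat \<Rightarrow> nat list set" where
  "tree_verts d = {v. \<forall>i < length v. v ! i < (if i = 0 then d + 1 else d)}"

text \<open>The edges of the oriented tree, all pointing away from the root.\<close>

definition tree_edges :: "nat \<Rightarrow> (nat list \<times> nat list) set" where
  "tree_edges d = {(u, v). u \<in> tree_verts d \<and> v \<in> tree_verts d \<and> (\<exists>a. v = u @ [a])}"

definition tree_dist :: "nat \<Rightarrow> nat list \<Rightarrow> nat list \<Rightarrow> nat" where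
  "tree_dist d u v = (LEAST n. (u, v) \<in> (tree_edges d \<union> (tree_edges d)\<inverse>) ^^ n)"

text \<open>
  The vertices on the path from the root to \<open>v\<close> are exactly the prefixes of \<open>v\<close>, so the
  order \<open>u < v\<close> of the tree is \<^const>\<open>strict_prefix\<close> (see \<open>strict_prefix_iff_path\<close>).

  The variable \<open>X v\<close> is the radius attached to \<open>v\<close>, and \<open>informed d X n\<close> is the set of
  vertices informed by time \<open>n\<close>; the vertices newly informed at time \<open>n + 1\<close> are those
  in \<open>informed d X (Suc n) - informed d X n\<close>.
\<close>

fun informed :: "nat \<Rightarrow> (nat list \<Rightarrow> nat) \<Rightarrow> nat \<Rightarrow> nat list set" where
  "informed d X 0 = {[]}"
| "informed d X (Suc 0) = {v \<in> tree_verts d. tree_dist d [] v \<le> X []}"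
| "informed d X (Suc (Suc n)) = informed d X (Suc n) \<union>
     {v' \<in> tree_verts d. \<exists>v \<in> informed d X (Suc n) - informed d X n.
        strict_prefix v v' \<and> tree_dist d v v' \<le> X v}"

definition percolates :: "nat \<Rightarrow> (nat list \<Rightarrow> nat) \<Rightarrow> bool" where
  "percolates d X \<longleftrightarrow> infinite (\<Union>n. informed d X n)"

text \<open>
  \<open>geometric_pmf s\<close> has success probability \<open>s\<close> and counts failures, so the law with
  \<open>P(X \<ge> k) = p ^ k\<close> is \<open>geometric_pmf (1 - p)\<close> (see \<open>geometric_tail\<close>).
\<close>

definition cone_space :: "nat \<Rightarrow> real \<Rightarrow> (nat list \<Rightarrow> nat) measure" where
  "cone_space d p = (\<Pi>\<^sub>M v \<in> tree_verts d. measure_pmf (geometric_pmf (1 - p)))"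

definition pc_cp :: "nat \<Rightarrow> real" where
  "pc_cp d = Inf {p. 0 < p \<and> p < 1 \<and> \<P>(X in cone_space d p. percolates d X) > 0}"

lemma prob_space_cone_space: "prob_space (cone_space d p)"
  unfolding cone_space_def by (intro prob_space_PiM measure_pmf.prob_space_axioms)

lemma geometric_tail:
  assumes "0 < p" "p < 1"
  shows "measure (measure_pmf (geometric_pmf (1 - p))) {k..} = p ^ k"
proof -
  have fin: "measure (measure_pmf (geometric_pmf (1 - p))) {..<k} = 1 - p ^ k"
  proof -
    have "measure (measure_pmf (geometric_pmf (1 - p))) {..<k} = (\<Sum>i<k. p ^ i * (1 - p))"
      using assms by (subst measure_measure_pmf_finite) auto
    also have "\<dots> = 1 - p ^ k"
      by (induction k) (auto simp: algebra_simps)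
    finally show ?thesis .
  qed
  have "{k..} = UNIV - {..<k}" by auto
  then show ?thesis
    using measure_pmf.prob_compl[of "{..<k}" "geometric_pmf (1 - p)"] fin by simp
qed

lemma Nil_in_tree_verts [simp]: "[] \<in> tree_verts d"
  by (simp add: tree_verts_def)

lemma snoc_in_tree_verts:
  "u @ [a] \<in> tree_verts d \<longleftrightarrow> u \<in> tree_verts d \<and> a < (if u = [] then d + 1 else d)"
proof -
  show ?thesis
    unfolding tree_verts_def mem_Collect_eq length_append_singleton All_less_Suc
    by (auto simp: nth_append)
qed

lemma card_neighbours:
  assumes "v \<in> tree_verts d"
  shows "card {w. (v, w) \<in> tree_edges d \<union> (tree_edges d)\<inverse>} = d + 1"
proof (cases v rule: rev_cases)
  case Nil
  have "{w. (v, w) \<in> tree_edges d \<union> (tree_edges d)\<inverse>} = (\<lambda>a. [a]) ` {..<d + 1}"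
    using Nil snoc_in_tree_verts[of "[]"] by (auto simp: tree_edges_def)
  then show ?thesis by (simp add: card_image inj_on_def)
next
  case (snoc u b)
  have "{w. (v, w) \<in> tree_edges d \<union> (tree_edges d)\<inverse>} = insert u ((\<lambda>a. v @ [a]) ` {..<d})"
    using snoc assms snoc_in_tree_verts[of v] snoc_in_tree_verts[of u b]
    by (auto simp: tree_edges_def)
  moreover have "u \<notin> (\<lambda>a. v @ [a]) ` {..<d}" using snoc by auto
  ultimately show ?thesis by (simp add: card_image inj_on_def)
qed

lemma strict_prefix_iff_path:
  assumes "v \<in> tree_verts d"
  shows "strict_prefix u v \<longleftrightarrow> u \<noteq> v \<and> (u, v) \<in> (tree_edges d)\<^sup>*"
proof -
  have "prefix u v" if "(u, v) \<in> (tree_edges d)\<^sup>*"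
    using that
    by induction (auto simp: tree_edges_def)
  moreover have "(u, v) \<in> (tree_edges d)\<^sup>*" if "prefix u v"
    using that assms
  proof (induction v rule: rev_induct)
    case (snoc a v)
    show ?case
    proof (cases "u = v @ [a]")
      case False
      then have "(u, v) \<in> (tree_edges d)\<^sup>*"
        using snoc snoc_in_tree_verts[of v a] by auto
      moreover have "(v, v @ [a]) \<in> tree_edges d"
        using snoc.prems snoc_in_tree_verts[of v a] by (auto simp: tree_edges_def)
      ultimately show ?thesis by (rule rtrancl_into_rtrancl)
    qed simp
  qed simp
  ultimately show ?thesis by (auto simp: strict_prefix_def)
qed

lemma tree_dist_prefix:
  assumes "v \<in> tree_verts d" "prefix u v"
  shows "tree_dist d u v = length v - length u"
proof -
  let ?A = "tree_edges d \<union> (tree_edges d)\<inverse>"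
  have lower: "length y \<le> length x + n" if "(x, y) \<in> ?A ^^ n" for x y n
    using that
  proof (induction n arbitrary: y)
    case (Suc n)
    then obtain z where "(x, z) \<in> ?A ^^ n" "(z, y) \<in> ?A" by auto
    moreover from this(2) have "length y \<le> Suc (length z)" by (auto simp: tree_edges_def)
    ultimately show ?case using Suc.IH[of z] by simp
  qed simp
  obtain w where v: "v = u @ w" using assms(2) by (auto simp: prefix_def)
  have "(u, u @ w) \<in> ?A ^^ length w" if "u @ w \<in> tree_verts d" for w
    using that
  proof (induction w rule: rev_induct)
    case (snoc a w)
    then have 1: "u @ w \<in> tree_verts d" using snoc_in_tree_verts[of "u @ w" a] by simp
    then have "(u @ w, u @ w @ [a]) \<in> ?A" using snoc.prems by (auto simp: tree_edges_def)
    with snoc.IH[OF 1] show ?case by auto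
  qed simp
  then have "(u, v) \<in> ?A ^^ length w" using assms(1) v by simp
  moreover have "length w \<le> n" if "(u, v) \<in> ?A ^^ n" for n
    using lower[OF that] v by simp
  ultimately show ?thesis unfolding tree_dist_def using v
    by (intro Least_equality) auto
qed

end

theory Submission
  imports Defs
begin

text \<open>
  Along a ray with radii \<open>Y 0, Y 1, \<dots>\<close>, level \<open>n\<close> is informed iff each of the levels
  \<open>1, \<dots>, n\<close> is covered by an earlier vertex. Decomposing according to the last vertex that
  covers level \<open>n\<close> gives a renewal equation for the probability \<open>Q n\<close> of this event, and
  \<open>a n = d ^ n * Q n\<close> is the renewal sequence with weights
  \<open>h k = (d p) ^ k * (\<Prod>i<k. 1 - p ^ i)\<close> (product from \<open>i = 1\<close>). If \<open>a n\<close> tends to \<open>0\<close>, the first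
  moment method excludes percolation. If \<open>a n > 1\<close> for some \<open>n\<close>, then looking only at every \<open>n\<close>-th
  generation, and restarting there with fresh radii, embeds a supercritical branching process.

  For \<open>p < q \<le> 1/2\<close> the \<open>k\<close>-th weight grows at least by the factor \<open>c ^ k\<close> with
  \<open>c = q (1 - q) / (p (1 - p)) > 1\<close>, hence so does \<open>a k\<close>. If the weights at \<open>q\<close> sum to at most \<open>1\<close>,
  then \<open>a \<le> 1\<close> at \<open>q\<close> and \<open>a\<close> decays exponentially at every \<open>p < q\<close>. If the weights at \<open>p\<close> sum to
  at least \<open>1\<close>, then \<open>a\<close> is not summable at \<open>p\<close> and therefore exceeds \<open>1\<close> somewhere at every \<open>q > p\<close>.
  So the critical value is the point where the weights sum to \<open>1\<close>, and the explicit bounds follow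
  from \<open>1 - p - p ^ 2 \<le> (\<Prod>i<k. 1 - p ^ i) \<le> 1 - p\<close> for \<open>k \<ge> 2\<close>.
\<close>

subsection \<open>Product measures and linked rays\<close>

text \<open>Indexing by a whole type lets one construction serve both rays and trees, and makes
  shifts such as \<open>X (w @ x)\<close> total.\<close>

definition iid :: "'a pmf \<Rightarrow> ('i \<Rightarrow> 'a) measure" where
  "iid \<mu> = (\<Pi>\<^sub>M i\<in>UNIV. measure_pmf \<mu>)"

lemma prob_space_iid: "prob_space (iid \<mu>)"
  unfolding iid_def by (intro prob_space_PiM measure_pmf.prob_space_axioms)

lemma space_iid [simp]: "space (iid \<mu>) = UNIV"
  by (simp add: iid_def space_PiM)

lemma measurable_iid_coord: "(\<lambda>X. X i) \<in> measurable (iid \<mu>) (count_space UNIV)"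
  unfolding iid_def using measurable_component_singleton[of i UNIV "\<lambda>_. measure_pmf \<mu>"] by simp

lemma sets_iid_coord: "{X. P (X i)} \<in> sets (iid \<mu>)"
  using measurable_sets[OF measurable_iid_coord[of i \<mu>], of "{x. P x}"] by (simp add: vimage_def)

lemma measurable_iid_reindex: "(\<lambda>X i. X (f i)) \<in> measurable (iid \<mu>) (iid \<mu>)"
proof (subst (2) iid_def, rule measurable_PiM_single')
  show "(\<lambda>X. X (f i)) \<in> measurable (iid \<mu>) (measure_pmf \<mu>)" for i
    using measurable_iid_coord[of "f i" \<mu>] by simp
qed simp

text \<open>Coordinates picked along an injection are again i.i.d. with the same law. This is used
  for a ray inside the tree and for the subtree below a word.\<close>

lemma measure_iid_reindex:
  fixes f :: "'i \<Rightarrow> 'j"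
  assumes "inj f" "E \<in> sets (iid \<mu>)"
  shows "measure (iid \<mu>) {X. (\<lambda>i. X (f i)) \<in> E} = measure (iid \<mu>) E"
proof -
  have "distr (iid \<mu>) (iid \<mu>) (\<lambda>X i. X (f i)) = iid \<mu>"
    using distr_PiM_reindex[of UNIV "\<lambda>_. measure_pmf \<mu>" f UNIV] assms
    by (simp add: iid_def measure_pmf.prob_space_axioms restrict_UNIV)
  then have "measure (iid \<mu>) E = measure (distr (iid \<mu>) (iid \<mu>) (\<lambda>X i. X (f i))) E" by simp
  also have "\<dots> = measure (iid \<mu>) {X. (\<lambda>i. X (f i)) \<in> E}"
    by (subst measure_distr[OF measurable_iid_reindex assms(2)]) (simp add: vimage_def)
  finally show ?thesis by simp
qed

lemma measure_iid_box:
  assumes "finite J"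
  shows "measure (iid \<mu>) {X. \<forall>i\<in>J. X i \<in> B i} = (\<Prod>i\<in>J. measure (measure_pmf \<mu>) (B i))"
proof -
  interpret product_prob_space "\<lambda>_. measure_pmf \<mu>" UNIV
    by (intro product_prob_spaceI measure_pmf.prob_space_axioms)
  have "{X. \<forall>i\<in>J. X i \<in> B i} = prod_emb UNIV (\<lambda>_. measure_pmf \<mu>) J (Pi\<^sub>E J B)"
    by (auto simp: prod_emb_def restrict_def PiE_iff)
  then show ?thesis
    unfolding iid_def using assms by (simp add: measure_PiM_emb)
qed

text \<open>An event that ignores the coordinates outside \<open>C\<close> is the preimage of an
  event of the product over \<open>C\<close>, and disjoint blocks of coordinates are
  independent.\<close>

lemma measure_iid_Int:
  fixes E F :: "('i \<Rightarrow> 'a) set"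
  assumes E: "E \<in> sets (iid \<mu>)" and F: "F \<in> sets (iid \<mu>)" and CD: "C \<inter> D = {}"
    and depE: "\<And>X Y. (\<And>i. i \<in> C \<Longrightarrow> X i = Y i) \<Longrightarrow> X \<in> E \<Longrightarrow> Y \<in> E"
    and depF: "\<And>X Y. (\<And>i. i \<in> D \<Longrightarrow> X i = Y i) \<Longrightarrow> X \<in> F \<Longrightarrow> Y \<in> F"
  shows "measure (iid \<mu>) (E \<inter> F) = measure (iid \<mu>) E * measure (iid \<mu>) F"
proof -
  let ?M = "\<lambda>_::'i. measure_pmf \<mu>"
  interpret prob_space "iid \<mu> :: ('i \<Rightarrow> 'a) measure" by (rule prob_space_iid)
  have ind: "indep_vars ?M (\<lambda>i X. X i) (UNIV :: 'i set)"
    using distr_PiM_component[of UNIV ?M] prob_space_iid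
    by (subst indep_vars_iff_distr_eq_PiM')
       (auto simp: iid_def measure_pmf.prob_space_axioms restrict_UNIV measurable_component_singleton)
  \<comment> \<open>Filling up with \<open>undefined\<close> outside \<open>S\<close> gives a full
    configuration, which \<open>E\<close> (for \<open>S = C\<close>) or \<open>F\<close> (for
    \<open>S = D\<close>) cannot tell from the original.\<close>
  define ext :: "'i set \<Rightarrow> ('i \<Rightarrow> 'a) \<Rightarrow> 'i \<Rightarrow> 'a" where
    "ext = (\<lambda>S Y i. if i \<in> S then Y i else undefined)"
  have ext: "ext S \<in> measurable (PiM S ?M) (iid \<mu>)" for S
    unfolding iid_def
  proof (rule measurable_PiM_single')
    fix i
    show "(\<lambda>Y. ext S Y i) \<in> measurable (PiM S ?M) (measure_pmf \<mu>)"
      using measurable_component_singleton[of i S ?M] by (cases "i \<in> S") (simp_all add: ext_def)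
  qed simp
  have 1: "ext C -` E \<inter> space (PiM C ?M) \<in> sets (PiM C ?M)"
    by (rule measurable_sets[OF ext E])
  have 2: "ext D -` F \<inter> space (PiM D ?M) \<in> sets (PiM D ?M)"
    by (rule measurable_sets[OF ext F])
  have e: "X \<in> E \<longleftrightarrow> ext C (restrict X C) \<in> E" for X
    using depE[of X "ext C (restrict X C)"] depE[of "ext C (restrict X C)" X]
    by (auto simp: ext_def)
  have f: "X \<in> F \<longleftrightarrow> ext D (restrict X D) \<in> F" for X
    using depF[of X "ext D (restrict X D)"] depF[of "ext D (restrict X D)" X]
    by (auto simp: ext_def)
  have sp: "restrict X S \<in> space (PiM S ?M)" for X :: "'i \<Rightarrow> 'a" and S by (simp add: space_PiM)
  have pre: "(\<lambda>X. (restrict X C, restrict X D)) -`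
      ((ext C -` E \<inter> space (PiM C ?M)) \<times> (ext D -` F \<inter> space (PiM D ?M))) = E \<inter> F"
    "(\<lambda>X. restrict X C) -` (ext C -` E \<inter> space (PiM C ?M)) = E"
    "(\<lambda>X. restrict X D) -` (ext D -` F \<inter> space (PiM D ?M)) = F"
    using e f sp by auto
  then show ?thesis
    using indep_varD[OF indep_var_restrict[OF ind CD subset_UNIV subset_UNIV] 1 2]
    by (simp add: pre)
qed

section \<open>Linked rays and the renewal equation\<close>

definition linked :: "nat \<Rightarrow> (nat \<Rightarrow> nat) \<Rightarrow> bool" where
  "linked n Y \<longleftrightarrow> (\<forall>m<n. \<exists>i\<le>m. m < i + Y i)"

lemma linked_0 [simp]: "linked 0 Y"
  by (simp add: linked_def)

lemma linked_mono: "linked n Y \<Longrightarrow> m \<le> n \<Longrightarrow> linked m Y"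
  by (auto simp: linked_def)

lemma linked_cong: "(\<And>i. i < n \<Longrightarrow> Y i = Z i) \<Longrightarrow> linked n Y \<longleftrightarrow> linked n Z"
  unfolding linked_def by (intro all_cong ex_cong) auto

text \<open>From \<open>i\<close> on, the vertex at level \<open>i\<close> covers all further levels
  alone.\<close>

lemma linked_extend: "linked i Y \<Longrightarrow> n \<le> i + Y i \<Longrightarrow> linked n Y"
  unfolding linked_def by (metis linorder_not_le order_less_le_trans)

text \<open>The second block restarts at \<open>w\<close>: it uses only the radii of
  \<open>w\<close> and its descendants, which makes it independent of the first block.\<close>

lemma linked_append:
  assumes "linked (length w) (\<lambda>i. X (take i w))" "linked k (\<lambda>i. X (w @ take i v))"
  shows "linked (length w + k) (\<lambda>i. X (take i (w @ v)))"
  unfolding linked_def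
proof (intro allI impI)
  fix m assume m: "m < length w + k"
  show "\<exists>i\<le>m. m < i + X (take i (w @ v))"
  proof (cases "m < length w")
    case True
    then obtain i where "i \<le> m" "m < i + X (take i w)" using assms(1) by (auto simp: linked_def)
    then show ?thesis using True by (intro exI[of _ i]) simp
  next
    case False
    then have "m - length w < k" using m by simp
    then obtain i where "i \<le> m - length w" "m - length w < i + X (w @ take i v)"
      using assms(2) by (auto simp: linked_def)
    then show ?thesis using False by (intro exI[of _ "length w + i"]) auto
  qed
qed

lemma sets_iid_linked: "{Y. linked n Y} \<in> sets (iid \<mu>)"
proof -
  have "{Y. linked n Y} = (\<Inter>m\<in>{..<n}. \<Union>i\<in>{..m}. {Y. m < i + Y i})"
    by (auto simp: linked_def)
  also have "\<dots> \<in> sets (iid \<mu>)"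
    using sets.top[of "iid \<mu> :: (nat \<Rightarrow> nat) measure"]
    by (cases "n = 0") (auto intro!: sets.finite_INT sets.finite_UN sets_iid_coord[of "\<lambda>x. _ < _ + x"])
  finally show ?thesis .
qed

definition link_prob :: "real \<Rightarrow> nat \<Rightarrow> real" where
  "link_prob p n = measure (iid (geometric_pmf (1 - p))) {Y. linked n Y}"

lemma link_prob_nonneg: "0 \<le> link_prob p n"
  by (simp add: link_prob_def)

lemma link_prob_0 [simp]: "link_prob p 0 = 1"
proof -
  interpret prob_space "iid (geometric_pmf (1 - p)) :: (nat \<Rightarrow> nat) measure" by (rule prob_space_iid)
  show ?thesis using prob_space by (simp add: link_prob_def)
qed

text \<open>
  The event \<open>L k\<close> in the proof says that the last vertex covering level \<open>n + 1\<close> is at level \<open>n - k\<close>;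
  it is independent of the radii at the levels before \<open>n - k\<close>.
\<close>

lemma link_prob_Suc:
  assumes p: "0 < p" "p < 1"
  shows "link_prob p (Suc n) =
    (\<Sum>k\<le>n. p ^ Suc k * (\<Prod>i=1..k. 1 - p ^ i) * link_prob p (n - k))"
proof -
  let ?\<mu> = "geometric_pmf (1 - p)"
  let ?M = "iid ?\<mu> :: (nat \<Rightarrow> nat) measure"
  interpret prob_space ?M by (rule prob_space_iid)
  define B where "B k i = (if i = n - k then {Suc k..} else {..<Suc n - i})" for k i
  define L where "L k = {Y. \<forall>i\<in>{n - k..n}. Y i \<in> B k i}" for k
  have L: "Y \<in> L k \<longleftrightarrow> n < (n - k) + Y (n - k) \<and> (\<forall>i. n - k < i \<and> i \<le> n \<longrightarrow> i + Y i \<le> n)"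
    if "k \<le> n" for k Y
  proof -
    have "{n - k..n} = insert (n - k) {n - k<..n}" using that by auto
    then have "Y \<in> L k \<longleftrightarrow> Suc k \<le> Y (n - k) \<and> (\<forall>i\<in>{n - k<..n}. Y i < Suc n - i)"
      by (simp add: L_def B_def)
    then show ?thesis using that by (auto simp: less_diff_conv less_Suc_eq_le add.commute)
  qed
  have setsL: "L k \<in> sets ?M" for k
  proof -
    have "L k = (\<Inter>i\<in>{n - k..n}. {Y. Y i \<in> B k i})" by (auto simp: L_def)
    also have "\<dots> \<in> sets ?M"
      by (intro sets.finite_INT) (auto intro: sets_iid_coord)
    finally show ?thesis .
  qed
  have less: "measure (measure_pmf ?\<mu>) {..<m} = 1 - p ^ m" for m
  proof -
    have "{..<m} = UNIV - {m..}" by auto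
    then show ?thesis
      using measure_pmf.prob_compl[of "{m..}" ?\<mu>] geometric_tail[OF p, of m] by simp
  qed
  have probL: "prob (L k) = p ^ Suc k * (\<Prod>i=1..k. 1 - p ^ i)" if "k \<le> n" for k
  proof -
    have "prob (L k) = (\<Prod>i\<in>{n - k..n}. measure (measure_pmf ?\<mu>) (B k i))"
      unfolding L_def by (rule measure_iid_box) simp
    also have "{n - k..n} = insert (n - k) {n - k<..n}" using that by auto
    also have "(\<Prod>i\<in>\<dots>. measure (measure_pmf ?\<mu>) (B k i)) =
        p ^ Suc k * (\<Prod>i\<in>{n - k<..n}. 1 - p ^ (Suc n - i))"
      using geometric_tail[OF p, of "Suc k"] by (simp add: B_def less)
    also have "(\<Prod>i\<in>{n - k<..n}. 1 - p ^ (Suc n - i)) = (\<Prod>i=1..k. 1 - p ^ i)"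
      by (rule prod.reindex_bij_witness[where i = "\<lambda>i. Suc n - i" and j = "\<lambda>i. Suc n - i"])
         (use that in auto)
    finally show ?thesis .
  qed
  have split: "{Y. linked (Suc n) Y} = (\<Union>k\<in>{..n}. {Y. linked (n - k) Y} \<inter> L k)"
  proof (intro equalityI subsetI)
    fix Y assume "Y \<in> {Y. linked (Suc n) Y}"
    then have Y: "linked (Suc n) Y" by simp
    define S where "S = {i. i \<le> n \<and> n < i + Y i}"
    have "S \<noteq> {}" "finite S" using Y by (auto simp: S_def linked_def)
    then have max: "Max S \<in> S" "\<And>i. i \<in> S \<Longrightarrow> i \<le> Max S" by auto
    have "i + Y i \<le> n" if "Max S < i" "i \<le> n" for i
    proof (rule ccontr)
      assume "\<not> i + Y i \<le> n"
      then have "i \<in> S" using that(2) by (simp add: S_def)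
      then show False using max(2) that(1) by (simp add: leD)
    qed
    moreover have "Max S \<le> n" "n < Max S + Y (Max S)"
      using max(1) unfolding S_def by blast+
    ultimately have "Y \<in> L (n - Max S)"
      by (subst L) auto
    moreover have "linked (n - (n - Max S)) Y"
      using linked_mono[OF Y] by simp
    ultimately show "Y \<in> (\<Union>k\<in>{..n}. {Y. linked (n - k) Y} \<inter> L k)" by auto
  next
    fix Y assume "Y \<in> (\<Union>k\<in>{..n}. {Y. linked (n - k) Y} \<inter> L k)"
    then obtain k where "k \<le> n" "linked (n - k) Y" "Y \<in> L k" by auto
    then show "Y \<in> {Y. linked (Suc n) Y}"
      using linked_extend[of "n - k" Y "Suc n"] L by auto
  qed
  have "disjoint_family_on (\<lambda>k. {Y. linked (n - k) Y} \<inter> L k) {..n}"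
    unfolding disjoint_family_on_def
  proof (intro ballI impI)
    \<comment> \<open>For \<open>k < l\<close> the level \<open>n - k\<close> comes after
      \<open>n - l\<close> and still covers level \<open>n + 1\<close>, against the second condition
      in \<open>L l\<close>.\<close>
    have *: "False" if "k < l" "k \<le> n" "l \<le> n" "Y \<in> L k" "Y \<in> L l" for k l Y
    proof -
      have less: "n < (n - k) + Y (n - k)" using L that by blast
      have "\<forall>i. n - l < i \<and> i \<le> n \<longrightarrow> i + Y i \<le> n" using L that by blast
      moreover have "n - l < n - k" "n - k \<le> n" using that by simp_all
      ultimately have "(n - k) + Y (n - k) \<le> n" by blast
      then show False using less by simp
    qed
    fix k l assume "k \<in> {..n}" "l \<in> {..n}" "k \<noteq> l"
    then show "({Y. linked (n - k) Y} \<inter> L k) \<inter> ({Y. linked (n - l) Y} \<inter> L l) = {}"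
      using *[of k l] *[of l k] by (cases "k < l") auto
  qed
  then have "link_prob p (Suc n) = (\<Sum>k\<le>n. prob ({Y. linked (n - k) Y} \<inter> L k))"
    unfolding link_prob_def split
    by (intro finite_measure_finite_Union) (auto intro: sets_iid_linked setsL)
  also have "\<dots> = (\<Sum>k\<le>n. p ^ Suc k * (\<Prod>i=1..k. 1 - p ^ i) * link_prob p (n - k))"
  proof (intro sum.cong refl)
    fix k assume "k \<in> {..n}"
    then have k: "k \<le> n" by simp
    have "prob ({Y. linked (n - k) Y} \<inter> L k) = prob {Y. linked (n - k) Y} * prob (L k)"
    proof (rule measure_iid_Int[OF sets_iid_linked setsL])
      show "{..<n - k} \<inter> {n - k..n} = {}" by auto
      show "Y \<in> {Y. linked (n - k) Y}"
        if "\<And>i. i \<in> {..<n - k} \<Longrightarrow> X i = Y i" "X \<in> {Y. linked (n - k) Y}" for X Y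
        using that linked_cong[of "n - k" X Y] by auto
      show "Y \<in> L k" if "\<And>i. i \<in> {n - k..n} \<Longrightarrow> X i = Y i" "X \<in> L k" for X Y
        using that unfolding L_def by auto
    qed
    then show "prob ({Y. linked (n - k) Y} \<inter> L k) =
        p ^ Suc k * (\<Prod>i=1..k. 1 - p ^ i) * link_prob p (n - k)"
      by (simp only: probL[OF k] link_prob_def mult.commute)
  qed
  finally show ?thesis .
qed

subsection \<open>Informed vertices and the first moment bound\<close>

abbreviation reached :: "nat \<Rightarrow> (nat list \<Rightarrow> nat) \<Rightarrow> nat list set" where
  "reached d X \<equiv> \<Union>n. informed d X n"

lemma informed_subset: "informed d X n \<subseteq> tree_verts d"
  by (induction d X n rule: informed.induct) auto

lemma Nil_in_informed: "[] \<in> informed d X n"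
proof (induction d X n rule: informed.induct)
  case (2 d X)
  then show ?case by (simp add: tree_dist_prefix[of "[]" d "[]", simplified])
qed auto

text \<open>Only newly informed vertices inform others, so the rule is applied right after the first
  time \<open>n\<close> at which \<open>u\<close> is informed. For \<open>n = 0\<close> the vertex
  \<open>u\<close> is the root.\<close>

lemma reached_step:
  assumes u: "u \<in> reached d X" and v: "v \<in> tree_verts d" "strict_prefix u v"
    and le: "length v \<le> length u + X u"
  shows "v \<in> reached d X"
proof -
  define n where "n = (LEAST n. u \<in> informed d X n)"
  have n: "u \<in> informed d X n"
    using u unfolding n_def by (auto intro: LeastI)
  have dist: "tree_dist d u v \<le> X u"
    using tree_dist_prefix[of v d u] v le by (auto simp: strict_prefix_def)
  show ?thesis
  proof (cases n)
    case 0
    then have "v \<in> informed d X (Suc 0)" using n v dist by simp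
    then show ?thesis by blast
  next
    case (Suc m)
    then have "u \<notin> informed d X m"
      using not_less_Least[of m "\<lambda>n. u \<in> informed d X n"] by (simp add: n_def)
    then have "v \<in> informed d X (Suc (Suc m))" using n Suc v dist by auto
    then show ?thesis by blast
  qed
qed

lemma reached_cases:
  assumes "v \<in> informed d X n" "v \<noteq> []"
  shows "\<exists>u \<in> reached d X. strict_prefix u v \<and> length v \<le> length u + X u"
  using assms
proof (induction d X n arbitrary: v rule: informed.induct)
  case (1 d X)
  then show ?case by simp
next
  case (2 d X)
  then have "length v \<le> X []" using tree_dist_prefix[of v d "[]"] by simp
  then show ?case
    using 2 Nil_in_informed[of d X] by (intro bexI[of _ "[]"]) (auto simp: strict_prefix_def)
next
  case (3 d X n)
  show ?case
  proof (cases "v \<in> informed d X (Suc n)")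
    case True
    then show ?thesis using 3 by blast
  next
    case False
    then obtain u where u: "u \<in> informed d X (Suc n)" "strict_prefix u v" "tree_dist d u v \<le> X u"
      and v: "v \<in> tree_verts d"
      using 3 by auto
    then have "length v \<le> length u + X u"
      using tree_dist_prefix[of v d u] by (auto simp: strict_prefix_def)
    then show ?thesis using u by blast
  qed
qed

lemma take_in_tree_verts: "v \<in> tree_verts d \<Longrightarrow> take n v \<in> tree_verts d"
  by (auto simp: tree_verts_def)

text \<open>Forward, the vertex that informs \<open>v\<close> is linked by induction and covers the
  remaining levels. Backward, some proper prefix of \<open>v\<close> covers the level of
  \<open>v\<close>; that prefix is itself linked, hence informed, and informs
  \<open>v\<close>.\<close>

lemma reached_iff_linked:
  "v \<in> reached d X \<longleftrightarrow> v \<in> tree_verts d \<and> linked (length v) (\<lambda>i. X (take i v))"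
proof (induction "length v" arbitrary: v rule: less_induct)
  case less
  show ?case
  proof
    assume v: "v \<in> reached d X"
    then have tree: "v \<in> tree_verts d" using informed_subset by blast
    have "linked (length v) (\<lambda>i. X (take i v))"
    proof (cases "v = []")
      case False
      then obtain u where u: "u \<in> reached d X" "strict_prefix u v" "length v \<le> length u + X u"
        using v reached_cases by blast
      then obtain z where z: "v = u @ z" "z \<noteq> []"
        by (auto simp: strict_prefix_def prefix_def)
      then have len: "length u < length v" by simp
      have "linked (length u) (\<lambda>i. X (take i u))" using less[OF len] u by simp
      then have "linked (length u) (\<lambda>i. X (take i v))"
        by (subst linked_cong[where Z = "\<lambda>i. X (take i u)"]) (simp_all add: z)
      then show ?thesis by (rule linked_extend) (use z u in simp)
    qed simp
    with tree show "v \<in> tree_verts d \<and> linked (length v) (\<lambda>i. X (take i v))" by simp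
  next
    assume v: "v \<in> tree_verts d \<and> linked (length v) (\<lambda>i. X (take i v))"
    show "v \<in> reached d X"
    proof (cases "v = []")
      case True
      then show ?thesis using Nil_in_informed by blast
    next
      case False
      then have "length v - 1 < length v" by simp
      then obtain i where i: "i \<le> length v - 1" "length v - 1 < i + X (take i v)"
        using v unfolding linked_def by blast
      have len: "length (take i v) = i" "i < length v"
        using i(1) \<open>length v - 1 < length v\<close> by auto
      have "linked i (\<lambda>j. X (take j (take i v)))"
        using linked_mono[of "length v" _ i] v len
        by (subst linked_cong[where Z = "\<lambda>j. X (take j v)"]) (auto simp: min_def)
      then have "take i v \<in> reached d X"
        using less[of "take i v"] len v take_in_tree_verts by metis
      moreover have "strict_prefix (take i v) v"
        using len by (metis nat_neq_iff strict_prefix_def take_is_prefix)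
      ultimately show ?thesis
        using v i len by (intro reached_step[of "take i v" d X v]) simp_all
    qed
  qed
qed

section \<open>Levels of the tree and the union bound\<close>

definition level :: "nat \<Rightarrow> nat \<Rightarrow> nat list set" where
  "level d n = {v \<in> tree_verts d. length v = n}"

lemma level_0: "level d 0 = {[]}"
  by (auto simp: level_def)

text \<open>Level \<open>n\<close> has \<open>(d + 1) * d ^ (n - 1)\<close> vertices for
  \<open>n \<ge> 1\<close>; the factor \<open>2\<close> absorbs
  \<open>d + 1 \<le> 2 * d\<close>.\<close>

lemma level_bound:
  assumes "1 \<le> d"
  shows "finite (level d n) \<and> card (level d n) \<le> 2 * d ^ n"
proof (induction n)
  case 0
  show ?case by (simp add: level_0)
next
  case (Suc n)
  let ?B = "{..<if n = 0 then d + 1 else d}"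
  have sub: "level d (Suc n) \<subseteq> (\<lambda>(u, a). u @ [a]) ` (level d n \<times> ?B)"
  proof
    fix v assume v: "v \<in> level d (Suc n)"
    then obtain u a where "v = u @ [a]" by (cases v rule: rev_cases) (auto simp: level_def)
    then show "v \<in> (\<lambda>(u, a). u @ [a]) ` (level d n \<times> ?B)"
      using v by (force simp: level_def snoc_in_tree_verts)
  qed
  have fin: "finite (level d n \<times> ?B)" using Suc by simp
  have "card (level d (Suc n)) \<le> card (level d n \<times> ?B)"
    by (rule order_trans[OF card_mono[OF finite_imageI[OF fin] sub] card_image_le[OF fin]])
  also have "\<dots> \<le> 2 * d ^ Suc n"
  proof (cases n)
    case 0
    then show ?thesis using assms by (simp add: card_cartesian_product level_0)
  next
    case (Suc m)
    then show ?thesis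
      using mult_right_mono[of "card (level d n)" "2 * d ^ n" d] \<open>finite _ \<and> _\<close>
      by (simp add: card_cartesian_product mult_ac)
  qed
  finally show ?case using finite_subset[OF sub finite_imageI[OF fin]] by simp
qed

text \<open>Levels are finite and prefixes of informed vertices are informed, so an infinite
  informed set meets every level. This form shows measurability and prepares the first moment
  bound.\<close>

lemma percolates_iff_linked:
  assumes "1 \<le> d"
  shows "percolates d X \<longleftrightarrow> (\<forall>n. \<exists>v\<in>level d n. linked n (\<lambda>i. X (take i v)))"
proof
  assume inf: "percolates d X"
  show "\<forall>n. \<exists>v\<in>level d n. linked n (\<lambda>i. X (take i v))"
  proof
    fix n
    have "finite (\<Union>m<n. level d m)" using level_bound[OF assms] by blast
    then have "\<not> reached d X \<subseteq> (\<Union>m<n. level d m)"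
      using inf finite_subset unfolding percolates_def by blast
    then obtain v where v: "v \<in> reached d X" "v \<notin> (\<Union>m<n. level d m)" by blast
    then have "n \<le> length v" "v \<in> tree_verts d" "linked (length v) (\<lambda>i. X (take i v))"
      using reached_iff_linked[of v d X] by (auto simp: level_def not_less[symmetric])
    moreover from this have "linked n (\<lambda>i. X (take i (take n v)))"
      using linked_mono[of "length v" _ n]
      by (subst linked_cong[where Z = "\<lambda>i. X (take i v)"]) (auto simp: min_def)
    ultimately show "\<exists>v\<in>level d n. linked n (\<lambda>i. X (take i v))"
      by (intro bexI[of _ "take n v"]) (auto simp: level_def take_in_tree_verts)
  qed
next
  assume R: "\<forall>n. \<exists>v\<in>level d n. linked n (\<lambda>i. X (take i v))"
  have "range (\<lambda>n::nat. n) \<subseteq> length ` reached d X"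
  proof
    fix n
    obtain v where "v \<in> level d n" "linked n (\<lambda>i. X (take i v))" using R by blast
    then show "n \<in> length ` reached d X"
      using reached_iff_linked[of v d X] by (auto simp: level_def)
  qed
  then have "infinite (length ` reached d X)"
    using infinite_super[of "UNIV :: nat set"] by auto
  then show "percolates d X" unfolding percolates_def using finite_imageI by blast
qed

lemma sets_iid_linked_take: "{X. linked n (\<lambda>i. X (take i v))} \<in> sets (iid \<mu>)"
  using measurable_sets[OF measurable_iid_reindex[of "\<lambda>i. take i v" \<mu>] sets_iid_linked[of n \<mu>]]
  by (simp add: vimage_def)

lemma measure_linked_take:
  assumes "n \<le> length v"
  shows "measure (iid (geometric_pmf (1 - p))) {X. linked n (\<lambda>i. X (take i (v :: nat list)))} = link_prob p n"
proof -
  let ?\<mu> = "geometric_pmf (1 - p)"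
  \<comment> \<open>\<open>path\<close> is an infinite ray that starts with \<open>v\<close>.\<close>
  define path where "path i = take i (v @ replicate i 0)" for i
  have "length (path i) = i" for i by (simp add: path_def)
  then have "inj path" by (metis injI)
  then have "link_prob p n = measure (iid ?\<mu>) {X. (\<lambda>i. X (path i)) \<in> {Y. linked n Y}}"
    unfolding link_prob_def by (rule measure_iid_reindex[symmetric]) (rule sets_iid_linked)
  also have "{X. (\<lambda>i. X (path i)) \<in> {Y. linked n Y}} = {X. linked n (\<lambda>i. X (take i v))}"
    using assms by (intro Collect_cong) (auto simp: path_def cong: linked_cong)
  finally show ?thesis ..
qed

lemma sets_iid_percolates:
  assumes "1 \<le> d"
  shows "{X. percolates d X} \<in> sets (iid \<mu>)"
proof -
  have "{X. percolates d X} = (\<Inter>n. \<Union>v\<in>level d n. {X. linked n (\<lambda>i. X (take i v))})"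
    by (auto simp: percolates_iff_linked[OF assms])
  also have "\<dots> \<in> sets (iid \<mu>)"
    using level_bound[OF assms]
    by (intro sets.countable_INT) (auto intro!: sets.finite_UN sets_iid_linked_take)
  finally show ?thesis .
qed

lemma prob_percolates_eq:
  assumes "1 \<le> d"
  shows "\<P>(X in cone_space d p. percolates d X) = measure (iid (geometric_pmf (1 - p))) {X. percolates d X}"
proof -
  let ?\<mu> = "geometric_pmf (1 - p)"
  let ?T = "tree_verts d"
  let ?r = "\<lambda>X. restrict X ?T"
  let ?P = "{X \<in> space (cone_space d p). percolates d X}"
  have eq: "distr (iid ?\<mu>) (cone_space d p) ?r = cone_space d p"
    using distr_PiM_reindex[of UNIV "\<lambda>_. measure_pmf ?\<mu>" "\<lambda>x. x" ?T]
    by (simp add: iid_def cone_space_def measure_pmf.prob_space_axioms)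
  \<comment> \<open>Extension by \<open>0\<close> off the tree; pulling back along \<open>e\<close>
    gives measurability of percolation in \<open>cone_space\<close>.\<close>
  define e :: "(nat list \<Rightarrow> nat) \<Rightarrow> nat list \<Rightarrow> nat" where "e Y i = (if i \<in> ?T then Y i else 0)" for Y i
  have e: "e \<in> measurable (cone_space d p) (iid ?\<mu>)"
    unfolding iid_def
  proof (rule measurable_PiM_single')
    fix i
    show "(\<lambda>Y. e Y i) \<in> measurable (cone_space d p) (measure_pmf ?\<mu>)"
      using measurable_component_singleton[of i ?T "\<lambda>_. measure_pmf ?\<mu>"]
      by (cases "i \<in> ?T") (simp_all add: e_def cone_space_def)
  qed simp
  have cong: "percolates d X \<longleftrightarrow> percolates d Y" if "\<And>v. v \<in> ?T \<Longrightarrow> X v = Y v" for X Y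
    using that unfolding percolates_iff_linked[OF assms]
    by (intro all_cong1 bex_cong refl linked_cong) (auto simp: level_def take_in_tree_verts)
  have "percolates d (e Y) \<longleftrightarrow> percolates d Y" for Y
    by (rule cong) (simp add: e_def)
  then have "?P = e -` {X. percolates d X} \<inter> space (cone_space d p)"
    by auto
  then have "?P \<in> sets (cone_space d p)"
    using measurable_sets[OF e sets_iid_percolates[OF assms]] by simp
  moreover have "?r \<in> measurable (iid ?\<mu>) (cone_space d p)"
    unfolding iid_def cone_space_def by (rule measurable_restrict_subset) simp
  ultimately have "measure (distr (iid ?\<mu>) (cone_space d p) ?r) ?P = measure (iid ?\<mu>) {X. ?r X \<in> ?P}"
    by (simp add: measure_distr vimage_def)
  also have "{X. ?r X \<in> ?P} = {X. percolates d X}"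
  proof -
    have "percolates d (?r X) \<longleftrightarrow> percolates d X" for X
      by (rule cong) simp
    then show ?thesis by (auto simp: cone_space_def space_PiM)
  qed
  finally show ?thesis by (simp only: eq)
qed

text \<open>Union bound over the vertices of level \<open>n\<close>.\<close>

lemma prob_percolates_le:
  assumes "1 \<le> d"
  shows "\<P>(X in cone_space d p. percolates d X) \<le> 2 * (real d ^ n * link_prob p n)"
proof -
  let ?M = "iid (geometric_pmf (1 - p)) :: (nat list \<Rightarrow> nat) measure"
  interpret prob_space ?M by (rule prob_space_iid)
  let ?E = "\<lambda>v. {X. linked n (\<lambda>i. X (take i v))}"
  note fin = level_bound[OF assms, THEN conjunct1]
  have "prob {X. percolates d X} \<le> prob (\<Union>v\<in>level d n. ?E v)"
    using fin by (intro finite_measure_mono) (auto simp: percolates_iff_linked[OF assms] intro!: sets.finite_UN sets_iid_linked_take)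
  also have "\<dots> \<le> (\<Sum>v\<in>level d n. prob (?E v))"
    using fin by (intro finite_measure_subadditive_finite) (auto intro: sets_iid_linked_take)
  also have "\<dots> = real (card (level d n)) * link_prob p n"
    by (simp add: measure_linked_take level_def)
  also have "\<dots> \<le> real (2 * d ^ n) * link_prob p n"
    using level_bound[OF assms, of n] by (intro mult_right_mono link_prob_nonneg) (simp only: of_nat_le_iff)
  finally show ?thesis by (simp add: prob_percolates_eq[OF assms])
qed

subsection \<open>The embedded branching process\<close>

text \<open>Bonferroni's inequality, with the number of pairs generously replaced by the square of
  the cardinality.\<close>

lemma (in prob_space) prob_UN_ge:
  assumes "finite W" and E: "\<And>w. w \<in> W \<Longrightarrow> E w \<in> events"
    and b: "\<And>v w. v \<in> W \<Longrightarrow> w \<in> W \<Longrightarrow> v \<noteq> w \<Longrightarrow> prob (E v \<inter> E w) \<le> b" "0 \<le> b"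
  shows "(\<Sum>w\<in>W. prob (E w)) - (real (card W))\<^sup>2 * b \<le> prob (\<Union>w\<in>W. E w)"
  using assms(1) E b(1)
proof (induction W)
  case empty
  then show ?case by simp
next
  case (insert a W)
  let ?U = "\<Union>w\<in>W. E w"
  have U: "?U \<in> events" using insert by (intro sets.finite_UN) auto
  have "prob (E a \<inter> ?U) \<le> (\<Sum>w\<in>W. prob (E a \<inter> E w))"
    using insert by (simp only: Int_UN_distrib) (intro finite_measure_subadditive_finite, auto)
  also have "\<dots> \<le> real (card W) * b"
    using insert by (intro sum_bounded_above) auto
  finally have "prob (E a \<inter> ?U) \<le> real (card W) * b" .
  moreover have "prob (E a \<union> ?U) = prob (E a) + prob ?U - prob (E a \<inter> ?U)"
    using U insert.prems(1)[of a] by (intro measure_Un3) (auto simp: fmeasurable_eq_sets)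
  moreover have "(\<Sum>w\<in>W. prob (E w)) - (real (card W))\<^sup>2 * b \<le> prob ?U"
    by (rule insert.IH) (use insert in auto)
  moreover have "(real (card (insert a W)))\<^sup>2 * b = (real (card W))\<^sup>2 * b + 2 * (real (card W) * b) + b"
    using insert by (simp add: power2_eq_square algebra_simps)
  moreover have "0 \<le> real (card W) * b" using b(2) by simp
  ultimately show ?case
    unfolding UN_insert sum.insert[OF insert.hyps] using b(2) by linarith
qed

text \<open>Only \<open>d\<close> of the \<open>d + 1\<close> children of the root are kept, so that
  all subtrees look alike.\<close>

definition words :: "nat \<Rightarrow> nat \<Rightarrow> nat list set" where
  "words d n = {w. set w \<subseteq> {..<d} \<and> length w = n}"

lemma finite_words: "finite (words d n)" and card_words: "card (words d n) = d ^ n"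
  unfolding words_def by (simp_all add: finite_lists_length_eq card_lists_length_eq)

lemma words_subset_level: "words d n \<subseteq> level d n"
proof
  fix w assume w: "w \<in> words d n"
  have "w ! i < d" if "i < length w" for i
    using w nth_mem[OF that] by (auto simp: words_def)
  then show "w \<in> level d n"
    using w by (auto simp: level_def tree_verts_def words_def less_SucI)
qed

text \<open>Non-extinction up to generation \<open>j\<close> of a branching process that looks only
  at every \<open>n\<close>-th level. The children of a vertex are decided by radii in its own
  subtree, above their level.\<close>

primrec survives :: "nat \<Rightarrow> nat \<Rightarrow> nat \<Rightarrow> (nat list \<Rightarrow> nat) \<Rightarrow> bool" where
  "survives d n 0 X \<longleftrightarrow> True"
| "survives d n (Suc j) X \<longleftrightarrow>
     (\<exists>w\<in>words d n. linked n (\<lambda>i. X (take i w)) \<and> survives d n j (\<lambda>x. X (w @ x)))"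

lemma survives_SucD: "survives d n (Suc j) X \<Longrightarrow> survives d n j X"
proof (induction j arbitrary: X)
  case (Suc j)
  then obtain w where "w \<in> words d n" "linked n (\<lambda>i. X (take i w))" "survives d n (Suc j) (\<lambda>x. X (w @ x))"
    unfolding survives.simps(2)[of d n "Suc j"] by blast
  then show ?case using Suc.IH[of "\<lambda>x. X (w @ x)"] unfolding survives.simps(2)[of d n j X] by blast
qed simp

lemma survives_linked:
  "survives d n j X \<Longrightarrow> \<exists>v\<in>words d (j * n). linked (j * n) (\<lambda>i. X (take i v))"
proof (induction j arbitrary: X)
  case 0
  then show ?case by (auto simp: words_def)
next
  case (Suc j)
  then obtain w where w: "w \<in> words d n" "linked n (\<lambda>i. X (take i w))"
    and "survives d n j (\<lambda>x. X (w @ x))" by auto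
  then obtain v where v: "v \<in> words d (j * n)" "linked (j * n) (\<lambda>i. X (w @ take i v))"
    using Suc.IH by blast
  then have "linked (Suc j * n) (\<lambda>i. X (take i (w @ v)))"
    using linked_append[of w X "j * n" v] w by (simp add: words_def)
  moreover have "w @ v \<in> words d (Suc j * n)"
    using v w by (simp add: words_def)
  ultimately show ?case by blast
qed

lemma percolates_if_survives:
  assumes "1 \<le> d" "1 \<le> n" "\<And>j. survives d n j X"
  shows "percolates d X"
  unfolding percolates_iff_linked[OF assms(1)]
proof
  fix N
  obtain v where v: "v \<in> words d (N * n)" "linked (N * n) (\<lambda>i. X (take i v))"
    using survives_linked[OF assms(3)] by blast
  have N: "N \<le> N * n" using assms(2) by simp
  have "take N v \<in> level d N"
    using v N words_subset_level[of d "N * n"] by (auto simp: level_def take_in_tree_verts)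
  moreover have "linked N (\<lambda>i. X (take i (take N v)))"
    using linked_mono[OF v(2) N]
    by (subst linked_cong[where Z = "\<lambda>i. X (take i v)"]) (auto simp: min_def)
  ultimately show "\<exists>v\<in>level d N. linked N (\<lambda>i. X (take i v))" by blast
qed

lemma sets_iid_append: "E \<in> sets (iid \<mu>) \<Longrightarrow> {X. (\<lambda>x. X (w @ x)) \<in> E} \<in> sets (iid \<mu>)"
  using measurable_sets[OF measurable_iid_reindex[of "\<lambda>x. w @ x" \<mu>]] by (simp add: vimage_def)

lemma sets_iid_survives: "{X. survives d n j X} \<in> sets (iid \<mu>)"
proof (induction j)
  case 0
  show ?case using sets.top[of "iid \<mu> :: (nat list \<Rightarrow> nat) measure"] by simp
next
  case (Suc j)
  have "{X. survives d n (Suc j) X} = (\<Union>w\<in>words d n.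
      {X. linked n (\<lambda>i. X (take i w))} \<inter> {X. (\<lambda>x. X (w @ x)) \<in> {X. survives d n j X}})"
    by auto
  also have "\<dots> \<in> sets (iid \<mu>)"
    by (intro sets.finite_UN finite_words sets.Int sets_iid_linked_take sets_iid_append Suc)
  finally show ?case .
qed

definition survival_prob :: "nat \<Rightarrow> real \<Rightarrow> nat \<Rightarrow> nat \<Rightarrow> real" where
  "survival_prob d p n j = measure (iid (geometric_pmf (1 - p))) {X. survives d n j X}"

lemma survival_prob_0: "survival_prob d p n 0 = 1"
proof -
  interpret prob_space "iid (geometric_pmf (1 - p)) :: (nat list \<Rightarrow> nat) measure" by (rule prob_space_iid)
  show ?thesis using prob_space by (simp add: survival_prob_def)
qed

text \<open>Bonferroni's inequality makes pairwise independence of the subtrees sufficient.\<close>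

lemma survival_prob_Suc_ge:
  fixes d n j :: nat and p :: real
  defines "\<theta> \<equiv> survival_prob d p n"
  shows "real d ^ n * link_prob p n * \<theta> j - (real d ^ n)\<^sup>2 * (\<theta> j)\<^sup>2 \<le> \<theta> (Suc j)"
    and "1 \<le> d \<Longrightarrow> link_prob p n * \<theta> j \<le> \<theta> (Suc j)"
proof -
  let ?\<mu> = "geometric_pmf (1 - p)"
  let ?M = "iid ?\<mu> :: (nat list \<Rightarrow> nat) measure"
  interpret prob_space ?M by (rule prob_space_iid)
  define A where "A w = {X. linked n (\<lambda>i. X (take i w))}" for w :: "nat list"
  define S where "S w = {X. (\<lambda>x. X (w @ x)) \<in> {X. survives d n j X}}" for w
  have meas: "A w \<in> events" "S w \<in> events" for w
    unfolding A_def S_def by (intro sets_iid_linked_take sets_iid_append sets_iid_survives)+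
  have union: "{X. survives d n (Suc j) X} = (\<Union>w\<in>words d n. A w \<inter> S w)"
    by (auto simp: A_def S_def)
  have S: "prob (S w) = \<theta> j" for w
    unfolding S_def \<theta>_def survival_prob_def
    by (rule measure_iid_reindex) (auto intro: sets_iid_survives simp: inj_on_def)
  have depS: "Y \<in> S w" if "\<And>v. v \<in> range ((@) w) \<Longrightarrow> X v = Y v" "X \<in> S w" for w X Y
    using that by (simp add: S_def)
  have AS: "prob (A w \<inter> S w) = link_prob p n * \<theta> j" if w: "w \<in> words d n" for w
  proof -
    have len: "length w = n" using w by (simp add: words_def)
    have "prob (A w \<inter> S w) = prob (A w) * prob (S w)"
    proof (rule measure_iid_Int[OF meas])
      \<comment> \<open>\<open>linked n\<close> reads the prefixes of length below \<open>n\<close>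
        only, so the radius of \<open>w\<close> itself already belongs to the subtree.\<close>
      show "{u. length u < n} \<inter> range ((@) w) = {}" using len by auto
      show "Y \<in> A w" if "\<And>u. u \<in> {u. length u < n} \<Longrightarrow> X u = Y u" "X \<in> A w" for X Y
        using that linked_cong[of n "\<lambda>i. X (take i w)" "\<lambda>i. Y (take i w)"] by (simp add: A_def)
    qed (use depS in blast)
    then show ?thesis using measure_linked_take[of n w p] len by (simp add: S A_def)
  qed
  have le: "prob ((A v \<inter> S v) \<inter> (A w \<inter> S w)) \<le> (\<theta> j)\<^sup>2"
    if vw: "v \<in> words d n" "w \<in> words d n" "v \<noteq> w" for v w
  proof -
    \<comment> \<open>The link events \<open>A v\<close> and \<open>A w\<close> share radii and are
      dropped. The subtrees of two distinct words of equal length are disjoint.\<close>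
    have "prob ((A v \<inter> S v) \<inter> (A w \<inter> S w)) \<le> prob (S v \<inter> S w)"
      using meas by (intro finite_measure_mono) auto
    also have "\<dots> = prob (S v) * prob (S w)"
      by (rule measure_iid_Int[OF meas(2) meas(2), of "range ((@) v)" "range ((@) w)"])
         (use vw depS in \<open>auto simp: words_def\<close>)
    finally show ?thesis by (simp add: S power2_eq_square)
  qed
  have "(\<Sum>w\<in>words d n. prob (A w \<inter> S w)) - (real (card (words d n)))\<^sup>2 * (\<theta> j)\<^sup>2 \<le> \<theta> (Suc j)"
    unfolding \<theta>_def survival_prob_def union
    by (rule prob_UN_ge) (use meas le in \<open>auto simp: finite_words \<theta>_def survival_prob_def\<close>)
  then show "real d ^ n * link_prob p n * \<theta> j - (real d ^ n)\<^sup>2 * (\<theta> j)\<^sup>2 \<le> \<theta> (Suc j)"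
    by (simp add: AS card_words)
  assume "1 \<le> d"
  then have w: "replicate n 0 \<in> words d n" by (auto simp: words_def)
  have "prob (A (replicate n 0) \<inter> S (replicate n 0)) \<le> \<theta> (Suc j)"
    unfolding \<theta>_def survival_prob_def union
    by (intro finite_measure_mono sets.finite_UN sets.Int) (use w meas finite_words in auto)
  then show "link_prob p n * \<theta> j \<le> \<theta> (Suc j)" using AS[OF w] by simp
qed

lemma prob_percolates_pos:
  assumes d: "1 \<le> d" and big: "1 < real d ^ n * link_prob p n"
  shows "0 < \<P>(X in cone_space d p. percolates d X)"
proof -
  let ?\<mu> = "geometric_pmf (1 - p)"
  let ?M = "iid ?\<mu> :: (nat list \<Rightarrow> nat) measure"
  interpret prob_space ?M by (rule prob_space_iid)
  let ?\<theta> = "survival_prob d p n"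
  \<comment> \<open>Chosen so that \<open>d ^ n * link_prob p n - (d ^ n)^2 * x \<ge> 1\<close> for
    all \<open>x \<le> \<delta>\<close>.\<close>
  define \<delta> where "\<delta> = (real d ^ n * link_prob p n - 1) / (real d ^ n)\<^sup>2"
  \<comment> \<open>The \<open>1\<close> accounts for the initial survival probability.\<close>
  define \<epsilon> where "\<epsilon> = min 1 (link_prob p n * \<delta>)"
  have dn: "0 < real d ^ n" using d by simp
  have n: "1 \<le> n" using big by (cases n) auto
  have Q: "0 < link_prob p n"
    using big link_prob_nonneg[of p n] by (cases "link_prob p n = 0") auto
  have \<delta>: "0 < \<delta>" using big dn by (simp add: \<delta>_def)
  then have \<epsilon>: "0 < \<epsilon>" using Q by (simp add: \<epsilon>_def)
  \<comment> \<open>Below \<open>\<delta>\<close> the quadratic bound prevents a further decrease; above \<open>\<delta>\<close> a single word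
    keeps the next value from dropping below \<open>link_prob p n * \<delta>\<close>.\<close>
  have lower: "\<epsilon> \<le> ?\<theta> j" for j
  proof (induction j)
    case 0
    show ?case by (simp add: survival_prob_0 \<epsilon>_def)
  next
    case (Suc j)
    show ?case
    proof (cases "?\<theta> j \<le> \<delta>")
      case True
      then have "(real d ^ n)\<^sup>2 * ?\<theta> j \<le> real d ^ n * link_prob p n - 1"
        using dn by (simp add: \<delta>_def pos_le_divide_eq mult.commute)
      moreover have "0 \<le> ?\<theta> j" using Suc \<epsilon> by simp
      ultimately have "((real d ^ n)\<^sup>2 * ?\<theta> j) * ?\<theta> j \<le> (real d ^ n * link_prob p n - 1) * ?\<theta> j"
        by (rule mult_right_mono)
      then have "?\<theta> j \<le> real d ^ n * link_prob p n * ?\<theta> j - (real d ^ n)\<^sup>2 * (?\<theta> j)\<^sup>2"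
        by (simp add: power2_eq_square algebra_simps)
      then show ?thesis using survival_prob_Suc_ge(1)[of d n p j] Suc by linarith
    next
      case False
      then have "link_prob p n * \<delta> \<le> link_prob p n * ?\<theta> j" using Q by simp
      then show ?thesis using survival_prob_Suc_ge(2)[OF d, of p n j] by (simp add: \<epsilon>_def)
    qed
  qed
  \<comment> \<open>Continuity from above carries the uniform bound \<open>\<epsilon>\<close> over
    to survival for all \<open>j\<close>.\<close>
  have "(\<lambda>j. prob {X. survives d n j X}) \<longlonglongrightarrow> prob (\<Inter>j. {X. survives d n j X})"
    by (intro finite_Lim_measure_decseq decseq_SucI)
       (auto intro: sets_iid_survives dest: survives_SucD simp del: survives.simps)
  then have "\<epsilon> \<le> prob (\<Inter>j. {X. survives d n j X})"
    using lower unfolding survival_prob_def by (intro LIMSEQ_le_const) auto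
  also have "\<dots> \<le> prob {X. percolates d X}"
    by (intro finite_measure_mono sets_iid_percolates d) (auto intro: percolates_if_survives[OF d n])
  finally show ?thesis using \<epsilon> by (simp add: prob_percolates_eq[OF d])
qed

subsection \<open>The renewal weights\<close>

definition weight :: "nat \<Rightarrow> real \<Rightarrow> nat \<Rightarrow> real" where
  "weight d p k = (real d * p) ^ k * (\<Prod>i=1..k - 1. 1 - p ^ i)"

lemma prod_one_minus_power_bounds:
  fixes p :: real
  assumes "0 \<le> p" "p \<le> 1"
  shows "0 \<le> (\<Prod>i=1..k. 1 - p ^ i)" "(\<Prod>i=1..k. 1 - p ^ i) \<le> 1"
  using assms by (auto intro!: prod_nonneg prod_le_1 simp: power_le_one)

lemma weight_nonneg: "0 \<le> p \<Longrightarrow> p \<le> 1 \<Longrightarrow> 0 \<le> weight d p k"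
  unfolding weight_def by (intro mult_nonneg_nonneg prod_one_minus_power_bounds) auto

lemma weight_le: "0 \<le> p \<Longrightarrow> p \<le> 1 \<Longrightarrow> weight d p k \<le> (real d * p) ^ k"
  unfolding weight_def using prod_one_minus_power_bounds[of p "k - 1"]
  by (intro mult_left_le) auto

lemma summable_weight:
  assumes "0 \<le> p" "p \<le> 1" "real d * p < 1"
  shows "summable (\<lambda>k. weight d p (Suc k))"
proof (rule summable_comparison_test')
  show "summable (\<lambda>k. (real d * p) ^ Suc k)"
    using assms by (subst summable_Suc_iff) (simp add: summable_geometric)
  show "norm (weight d p (Suc k)) \<le> (real d * p) ^ Suc k" for k
    using weight_nonneg[of p d "Suc k"] weight_le[of p d "Suc k"] assms by simp
qed

text \<open>Writing \<open>1 - x ^ i\<close> as \<open>1 - x\<close> times a geometric sum shows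
  that each factor shrinks at most by \<open>r = (1 - q) / (1 - p)\<close> when \<open>p\<close>
  grows to \<open>q\<close>.\<close>

lemma weight_scale:
  assumes "0 < p" "p < q" "q < 1"
  shows "((q * (1 - q)) / (p * (1 - p))) ^ Suc k * weight d p (Suc k) \<le> weight d q (Suc k)"
proof -
  define r where "r = (1 - q) / (1 - p)"
  have r: "0 \<le> r" "r \<le> 1" using assms by (auto simp: r_def)
  have term_le: "r * (1 - p ^ i) \<le> 1 - q ^ i" for i
  proof -
    have "r * (1 - p ^ i) = (1 - q) * (\<Sum>j<i. p ^ j)"
      using assms by (simp add: r_def one_diff_power_eq)
    also have "\<dots> \<le> (1 - q) * (\<Sum>j<i. q ^ j)"
      using assms by (intro mult_left_mono sum_mono power_mono) auto
    finally show ?thesis by (simp add: one_diff_power_eq)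
  qed
  \<comment> \<open>One more factor \<open>r \<le> 1\<close> is given away, so that \<open>r\<close>
    gets the same exponent as \<open>real d * q\<close>.\<close>
  have "r ^ Suc k * (\<Prod>i=1..k. 1 - p ^ i) \<le> r ^ k * (\<Prod>i=1..k. 1 - p ^ i)"
    using r assms by (intro mult_right_mono power_decreasing prod_one_minus_power_bounds) auto
  also have "\<dots> = (\<Prod>i=1..k. r * (1 - p ^ i))"
    by (simp add: prod.distrib)
  also have "\<dots> \<le> (\<Prod>i=1..k. 1 - q ^ i)"
    using r assms by (intro prod_mono conjI term_le mult_nonneg_nonneg) (auto simp: power_le_one)
  finally have "(real d * q) ^ Suc k * (r ^ Suc k * (\<Prod>i=1..k. 1 - p ^ i)) \<le> weight d q (Suc k)"
    unfolding weight_def using assms by (intro mult_left_mono) auto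
  moreover have "(real d * q) * r = ((q * (1 - q)) / (p * (1 - p))) * (real d * p)"
    using assms by (simp add: r_def)
  then have "(real d * q) ^ Suc k * r ^ Suc k =
      ((q * (1 - q)) / (p * (1 - p))) ^ Suc k * (real d * p) ^ Suc k"
    by (simp only: power_mult_distrib[symmetric])
  ultimately show ?thesis
    by (simp only: weight_def mult.assoc[symmetric] diff_Suc_1)
qed

text \<open>The expected size of generation \<open>n\<close>, but for the factor \<open>(d + 1) / d\<close> due to the extra child of the root.\<close>

definition mean_linked :: "nat \<Rightarrow> real \<Rightarrow> nat \<Rightarrow> real" where
  "mean_linked d p n = real d ^ n * link_prob p n"

lemma mean_linked_0 [simp]: "mean_linked d p 0 = 1"
  by (simp add: mean_linked_def)

lemma mean_linked_nonneg: "0 \<le> mean_linked d p n"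
  by (simp add: mean_linked_def link_prob_nonneg)

lemma mean_linked_Suc:
  assumes "0 < p" "p < 1"
  shows "mean_linked d p (Suc n) = (\<Sum>k\<le>n. weight d p (Suc k) * mean_linked d p (n - k))"
proof -
  have "real d ^ Suc n * (p ^ Suc k * P * Q) = (real d * p) ^ Suc k * P * (real d ^ (n - k) * Q)"
    if "k \<le> n" for k and P Q :: real
  proof -
    have "real d ^ Suc n = real d ^ Suc k * real d ^ (n - k)"
      using that by (simp flip: power_add)
    then show ?thesis by (simp only: power_mult_distrib mult_ac)
  qed
  then show ?thesis
    unfolding mean_linked_def link_prob_Suc[OF assms] sum_distrib_left weight_def
    by (intro sum.cong refl) (simp only: diff_Suc_1 atMost_iff)
qed

text \<open>By the renewal equation each value is a combination of earlier values whose nonnegative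
  weights sum to at most \<open>1\<close>.\<close>

lemma mean_linked_le_1:
  assumes "0 < p" "p < 1" and le: "\<And>n. (\<Sum>k<n. weight d p (Suc k)) \<le> 1"
  shows "mean_linked d p n \<le> 1"
proof (induction n rule: less_induct)
  case (less n)
  show ?case
  proof (cases n)
    case (Suc m)
    have "mean_linked d p n \<le> (\<Sum>k\<le>m. weight d p (Suc k) * 1)"
      unfolding Suc mean_linked_Suc[OF assms(1,2)]
      using assms less Suc by (intro sum_mono mult_left_mono weight_nonneg) auto
    also have "\<dots> \<le> 1" using le[of "Suc m"] by (simp add: lessThan_Suc_atMost)
    finally show ?thesis .
  qed simp
qed

text \<open>The exponents in each term of the renewal equation add up to \<open>Suc m\<close>, so
  the growth factor splits between the weight and the earlier value.\<close>

lemma mean_linked_scale: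
  assumes "0 < p" "p < q" "q < 1"
  shows "((q * (1 - q)) / (p * (1 - p))) ^ n * mean_linked d p n \<le> mean_linked d q n"
proof (induction n rule: less_induct)
  case (less n)
  let ?c = "(q * (1 - q)) / (p * (1 - p))"
  show ?case
  proof (cases n)
    case (Suc m)
    have "?c ^ Suc m * mean_linked d p (Suc m) =
        (\<Sum>k\<le>m. (?c ^ Suc k * weight d p (Suc k)) * (?c ^ (m - k) * mean_linked d p (m - k)))"
      using assms unfolding mean_linked_Suc[OF assms(1) less_trans[OF assms(2,3)]] sum_distrib_left
    proof (intro sum.cong refl)
      fix k assume "k \<in> {..m}"
      then have "?c ^ Suc m = ?c ^ Suc k * ?c ^ (m - k)" by (simp flip: power_add)
      then show "?c ^ Suc m * (weight d p (Suc k) * mean_linked d p (m - k)) =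
          (?c ^ Suc k * weight d p (Suc k)) * (?c ^ (m - k) * mean_linked d p (m - k))"
        by (simp only: mult_ac)
    qed
    also have "\<dots> \<le> (\<Sum>k\<le>m. weight d q (Suc k) * mean_linked d q (m - k))"
      using assms less[unfolded Suc]
      by (intro sum_mono mult_mono weight_scale weight_nonneg mult_nonneg_nonneg mean_linked_nonneg) auto
    finally show ?thesis using assms by (simp only: Suc mean_linked_Suc)
  qed simp
qed

text \<open>The map \<open>x * (1 - x)\<close> increases strictly up to
  \<open>1 / 2\<close>.\<close>

lemma scale_gt_1:
  assumes "0 < p" "p < q" "q \<le> 1 / 2"
  shows "1 < (q * (1 - q)) / (p * (1 - p :: real))"
proof -
  have "0 < (q - p) * (1 - p - q)" using assms by (intro mult_pos_pos) auto
  then show ?thesis using assms by (simp add: less_divide_eq algebra_simps)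
qed

text \<open>With \<open>F\<close> and \<open>A\<close> the sums of the weights and of
  \<open>mean_linked\<close>, the Cauchy product turns the renewal equation into
  \<open>F * A = A - 1\<close>. Summability of the weights follows since the term with
  \<open>mean_linked d p 0 = 1\<close> is one summand.\<close>

lemma suminf_weight_less_1:
  assumes p: "0 < p" "p < 1" and sm: "summable (mean_linked d p)"
  shows "summable (\<lambda>k. weight d p (Suc k))" "(\<Sum>k. weight d p (Suc k)) < 1"
proof -
  let ?f = "\<lambda>k. weight d p (Suc k)" and ?a = "mean_linked d p"
  have f: "0 \<le> ?f k" for k using p by (simp add: weight_nonneg)
  have le: "?f k \<le> ?a (Suc k)" for k
  proof -
    have "?f k * ?a (k - k) \<le> ?a (Suc k)"
      unfolding mean_linked_Suc[OF p]
      by (rule member_le_sum[of k "{..k}" "\<lambda>i. ?f i * ?a (k - i)"]) (auto simp: f mean_linked_nonneg)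
    then show ?thesis by simp
  qed
  show sf: "summable ?f"
  proof (rule summable_comparison_test')
    show "summable (\<lambda>k. ?a (Suc k))" using sm by (subst summable_Suc_iff)
    show "norm (?f k) \<le> ?a (Suc k)" for k using le[of k] f[of k] by simp
  qed
  have "suminf ?f * suminf ?a = (\<Sum>n. \<Sum>k\<le>n. ?f k * ?a (n - k))"
    by (rule Cauchy_product) (use sm sf f mean_linked_nonneg in simp_all)
  also have "\<dots> = (\<Sum>n. ?a (Suc n))" by (simp add: mean_linked_Suc[OF p])
  also have "\<dots> = suminf ?a - 1" using suminf_split_head[OF sm] by simp
  finally have "suminf ?f * suminf ?a < suminf ?a" by simp
  moreover have "0 < suminf ?a"
    using sm mean_linked_nonneg[of d p] by (intro suminf_pos2[of _ 0]) auto
  ultimately show "suminf ?f < 1" by simp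
qed

subsection \<open>The critical value\<close>

definition weight_sum :: "nat \<Rightarrow> real \<Rightarrow> real" where
  "weight_sum d p = (\<Sum>k. weight d p (Suc k))"

abbreviation percolating :: "nat \<Rightarrow> real set" where
  "percolating d \<equiv> {p. 0 < p \<and> p < 1 \<and> \<P>(X in cone_space d p. percolates d X) > 0}"

lemma bdd_below_percolating: "bdd_below (percolating d)"
  by (rule bdd_belowI[of _ 0]) auto

lemma not_percolating:
  assumes d: "1 \<le> d" and q: "q \<le> 1 / 2" and p: "0 < p" "p < q"
    and le: "\<And>n. (\<Sum>k<n. weight d q (Suc k)) \<le> 1"
  shows "\<not> \<P>(X in cone_space d p. percolates d X) > 0"
proof -
  let ?P = "\<P>(X in cone_space d p. percolates d X)"
  define c where "c = (q * (1 - q)) / (p * (1 - p))"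
  have c: "1 < c" unfolding c_def using p q by (rule scale_gt_1)
  have "?P \<le> 2 * (1 / c) ^ n" for n
  proof -
    have "c ^ n * mean_linked d p n \<le> mean_linked d q n"
      unfolding c_def using p q by (intro mean_linked_scale) auto
    also have "\<dots> \<le> 1" using p q le by (intro mean_linked_le_1) auto
    finally have "mean_linked d p n \<le> (1 / c) ^ n"
      using c by (simp add: power_one_over field_simps)
    then show ?thesis
      using prob_percolates_le[OF d, of p n] by (simp add: mean_linked_def)
  qed
  moreover have "(\<lambda>n. 2 * (1 / c) ^ n) \<longlonglongrightarrow> 2 * 0"
    using c by (intro tendsto_intros LIMSEQ_power_zero) auto
  ultimately have "?P \<le> 2 * 0" by (intro LIMSEQ_le_const[of "\<lambda>n. 2 * (1 / c) ^ n"]) blast+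
  then show ?thesis by simp
qed

text \<open>If \<open>mean_linked d q\<close> never exceeded \<open>1\<close>, then
  \<open>mean_linked d p\<close> would decay geometrically and the weights at \<open>p\<close> would
  sum to less than \<open>1\<close>. The assumption on \<open>weight_sum\<close> is conditional
  because a divergent series also counts as large.\<close>

lemma mem_percolating:
  assumes d: "1 \<le> d" and p: "0 < p" "p < q" and q: "q \<le> 1 / 2"
    and ge: "summable (\<lambda>k. weight d p (Suc k)) \<Longrightarrow> 1 \<le> weight_sum d p"
  shows "q \<in> percolating d"
proof -
  define c where "c = (q * (1 - q)) / (p * (1 - p))"
  have c: "1 < c" unfolding c_def using p q by (rule scale_gt_1)
  obtain n where n: "1 < mean_linked d q n"
  proof (rule ccontr)
    assume "\<not> thesis"
    then have le: "mean_linked d q n \<le> 1" for n using that by (meson not_le)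
    have "summable (mean_linked d p)"
    proof (rule summable_comparison_test')
      show "summable (\<lambda>n. (1 / c) ^ n)" using c by (intro summable_geometric) auto
      fix n
      have "c ^ n * mean_linked d p n \<le> mean_linked d q n"
        unfolding c_def using p q by (intro mean_linked_scale) auto
      also note le
      finally show "norm (mean_linked d p n) \<le> (1 / c) ^ n"
        using c mean_linked_nonneg[of d p n] by (simp add: power_one_over field_simps)
    qed
    then show False
      using suminf_weight_less_1[of p d] ge p q by (auto simp: weight_sum_def)
  qed
  then show ?thesis
    using prob_percolates_pos[OF d, of n q] p q by (simp add: mean_linked_def)
qed

text \<open>Every \<open>q\<close> above \<open>p\<close> up to \<open>1 / 2\<close> percolates, and
  \<open>q\<close> may tend to \<open>p\<close>. Nonemptiness is recorded for the lower bound on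
  \<open>Inf\<close> in \<open>pc_cp_ge\<close>.\<close>

lemma pc_cp_le:
  assumes d: "1 \<le> d" and p: "0 < p" "p < 1 / 2"
    and ge: "summable (\<lambda>k. weight d p (Suc k)) \<Longrightarrow> 1 \<le> weight_sum d p"
  shows "percolating d \<noteq> {}" "pc_cp d \<le> p"
proof -
  have mem: "q \<in> percolating d" if "p < q" "q \<le> 1 / 2" for q
    using mem_percolating[OF d p(1) that ge] .
  show "percolating d \<noteq> {}" using mem[of "1 / 2"] p by blast
  show "pc_cp d \<le> p"
  proof (rule dense_ge_bounded)
    fix q assume q: "p < q" "q < 1 / 2"
    show "pc_cp d \<le> q"
      unfolding pc_cp_def by (rule cInf_lower[OF _ bdd_below_percolating]) (use mem q in simp)
  qed (fact p(2))
qed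

lemma pc_cp_ge:
  assumes d: "1 \<le> d" and q: "0 < q" "q \<le> 1 / 2"
    and le: "\<And>n. (\<Sum>k<n. weight d q (Suc k)) \<le> 1" and ne: "percolating d \<noteq> {}"
  shows "q \<le> pc_cp d"
  unfolding pc_cp_def
proof (rule cInf_greatest[OF ne])
  fix p assume "p \<in> percolating d"
  then show "q \<le> p" using not_percolating[OF d q(2) _ _ le, of p] by (cases "p < q") auto
qed

lemma has_sum_weight_iff:
  assumes "0 \<le> p" "p \<le> 1"
  shows "(weight d p has_sum s) {1..} \<longleftrightarrow> (\<lambda>k. weight d p (Suc k)) sums s"
proof -
  have "{1..} = range Suc" using Suc_le_D by (auto simp: image_iff)
  then have "(weight d p has_sum s) {1..} \<longleftrightarrow> ((\<lambda>k. weight d p (Suc k)) has_sum s) UNIV"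
    by (simp only:) (subst has_sum_reindex, simp_all add: o_def)
  also have "\<dots> \<longleftrightarrow> (\<lambda>k. weight d p (Suc k)) sums s"
    using weight_nonneg[OF assms] sums_nonneg_imp_has_sum has_sum_imp_sums by blast
  finally show ?thesis .
qed

text \<open>The second weight is positive, so the first one, \<open>real d * q\<close>, stays
  strictly below the total.\<close>

lemma sums_weight_less:
  assumes "2 \<le> d" "0 < q" "q < 1" "(\<lambda>k. weight d q (Suc k)) sums 1"
  shows "real d * q < 1"
proof -
  have "(\<Sum>k<2. weight d q (Suc k)) \<le> 1"
    using sum_le_suminf[OF sums_summable[OF assms(4)], of "{..<2}"] sums_unique[OF assms(4)]
      weight_nonneg[of q d] assms by simp
  moreover have "weight d q 1 = real d * q" "0 < weight d q 2"
    using assms by (simp_all add: weight_def)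
  ultimately show ?thesis by (simp add: numeral_2_eq_2)
qed

text \<open>Every solution is at once an upper and a lower bound of the critical value, so
  uniqueness needs no monotonicity of the series.\<close>

lemma pc_cp_unique:
  assumes d: "2 \<le> d" and q: "0 < q" "q < 1" and sums: "(\<lambda>k. weight d q (Suc k)) sums 1"
  shows "q = pc_cp d"
proof -
  have "2 * q \<le> real d * q" using d q by simp
  then have half: "q < 1 / 2" using sums_weight_less[OF d q sums] by linarith
  have "1 \<le> weight_sum d q" using sums_unique[OF sums] by (simp add: weight_sum_def)
  note le = pc_cp_le[OF _ q(1) half this]
  have "(\<Sum>k<n. weight d q (Suc k)) \<le> 1" for n
    using sum_le_suminf[OF sums_summable[OF sums], of "{..<n}"] sums_unique[OF sums]
      weight_nonneg[of q d] q by simp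
  then show ?thesis using le pc_cp_ge[of d q] d q half by force
qed

lemma continuous_on_weight_sum:
  assumes "0 < u" "u \<le> 1" "real d * u < 1"
  shows "continuous_on {0..u} (weight_sum d)"
proof -
  have "uniform_limit {0..u} (\<lambda>n p. \<Sum>k<n. weight d p (Suc k)) (weight_sum d) sequentially"
    unfolding weight_sum_def[abs_def]
  proof (rule Weierstrass_m_test)
    show "summable (\<lambda>k. (real d * u) ^ Suc k)"
      using assms by (subst summable_Suc_iff) (simp add: summable_geometric)
    fix k p assume p: "p \<in> {0..u}"
    then have "norm (weight d p (Suc k)) \<le> (real d * p) ^ Suc k"
      using weight_nonneg[of p d "Suc k"] weight_le[of p d "Suc k"] assms by simp
    also have "\<dots> \<le> (real d * u) ^ Suc k"
      using p by (intro power_mono mult_left_mono) auto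
    finally show "norm (weight d p (Suc k)) \<le> (real d * u) ^ Suc k" .
  qed
  then show ?thesis
    by (rule uniform_limit_theorem[rotated])
       (auto simp: weight_def intro!: always_eventually continuous_intros)
qed

text \<open>The intermediate value theorem gives a solution, which \<open>pc_cp_unique\<close>
  identifies.\<close>

lemma pc_cp_sums:
  assumes d: "2 \<le> d" and lu: "0 < l" "l \<le> u" "real d * u < 1"
    and l: "weight_sum d l \<le> 1" and u: "1 \<le> weight_sum d u"
  shows "0 < pc_cp d \<and> pc_cp d < 1 \<and> (\<lambda>k. weight d (pc_cp d) (Suc k)) sums 1"
proof -
  have "2 * u \<le> real d * u" using d lu by simp
  then have half: "u < 1 / 2" using lu by linarith
  have "continuous_on {l..u} (weight_sum d)"
    by (rule continuous_on_subset[OF continuous_on_weight_sum[of u d]]) (use lu half in auto)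
  then obtain q where q: "l \<le> q" "q \<le> u" "weight_sum d q = 1"
    using IVT'[of "weight_sum d" l 1 u] l u lu by auto
  have "real d * q < 1" using q lu by (meson le_less_trans mult_left_mono of_nat_0_le_iff)
  then have "(\<lambda>k. weight d q (Suc k)) sums 1"
    using summable_sums[OF summable_weight[of q d]] q lu half by (simp add: weight_sum_def)
  moreover from this have "q = pc_cp d"
    using pc_cp_unique[OF d] q lu half by simp
  ultimately show ?thesis using q lu half by simp
qed

section \<open>Explicit bounds on the critical value\<close>

text \<open>All products from the second weight on are at most \<open>1 - p\<close>, so the sum is
  at most \<open>t + t^2 * (1 - p) / (1 - t)\<close>; the assumption says that this is at most
  \<open>1\<close>.\<close>

lemma weight_sum_le_1:
  assumes p: "0 \<le> p" "p \<le> 1" and t: "t = real d * p" "t < 1"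
    and le: "t\<^sup>2 * (1 - p) \<le> (1 - t)\<^sup>2"
  shows "weight_sum d p \<le> 1"
proof -
  let ?f = "\<lambda>k. weight d p (Suc k)"
  have sf: "summable ?f" using summable_weight p t by simp
  have t0: "0 \<le> t" using p t by simp
  have prod: "(\<Prod>i=1..Suc k. 1 - p ^ i) \<le> 1 - p" for k
  proof (induction k)
    case (Suc k)
    have "(\<Prod>i=1..Suc (Suc k). 1 - p ^ i) \<le> (\<Prod>i=1..Suc k. 1 - p ^ i)"
      unfolding prod.cl_ivl_Suc[of _ 1 "Suc k"]
      using p prod_one_minus_power_bounds(1)[of p "Suc k"] by (simp add: mult_left_le del: prod.cl_ivl_Suc)
    then show ?case using Suc by linarith
  qed simp
  have gs: "(\<lambda>k. t\<^sup>2 * (1 - p) * t ^ k) sums (t\<^sup>2 * (1 - p) * (1 / (1 - t)))"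
    using t t0 by (intro sums_mult geometric_sums) simp
  have "?f (Suc k) \<le> t\<^sup>2 * (1 - p) * t ^ k" for k
  proof -
    have "?f (Suc k) = t ^ (k + 2) * (\<Prod>i=1..Suc k. 1 - p ^ i)"
      by (simp add: weight_def t(1) del: prod.cl_ivl_Suc)
    also have "\<dots> \<le> t ^ (k + 2) * (1 - p)"
      using prod t0 by (intro mult_left_mono) auto
    also have "\<dots> = t\<^sup>2 * (1 - p) * t ^ k" by (simp only: power_add mult_ac)
    finally show ?thesis .
  qed
  then have "(\<Sum>k. ?f (Suc k)) \<le> t\<^sup>2 * (1 - p) * (1 / (1 - t))"
    using suminf_le[OF _ _ sums_summable[OF gs], of "\<lambda>k. ?f (Suc k)"] sf sums_unique[OF gs]
    by (simp add: summable_Suc_iff[of ?f])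
  also have "\<dots> \<le> 1 - t"
    using le t by (simp add: divide_le_eq power2_eq_square)
  finally have "(\<Sum>k. ?f (Suc k)) \<le> 1 - t" .
  moreover have "?f 0 = t" by (simp add: weight_def t(1))
  ultimately show ?thesis
    using suminf_split_head[OF sf] by (simp add: weight_sum_def)
qed

text \<open>The first terms of Euler's pentagonal number series.\<close>

lemma prod_one_minus_power_ge:
  fixes p :: real
  assumes "0 \<le> p" "p \<le> 1"
  shows "1 - p - p\<^sup>2 + p ^ (k + 2) \<le> (\<Prod>i=1..Suc k. 1 - p ^ i)"
proof (induction k)
  case 0
  show ?case by (simp add: power2_eq_square)
next
  case (Suc k)
  define y where "y = p ^ (k + 2)"
  have y: "0 \<le> y" "y \<le> p\<^sup>2" "y \<le> 1"
    unfolding y_def using assms power_decreasing[of 2 "k + 2" p] power_le_one[of p "k + 2"]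
    by simp_all
  \<comment> \<open>This is exactly the difference of the two sides of the next inequality.\<close>
  have "0 \<le> y * (p\<^sup>2 - y)" using y by simp
  then have "1 - p - p\<^sup>2 + p * y \<le> (1 - p - p\<^sup>2 + y) * (1 - y)"
    by (simp add: algebra_simps power2_eq_square)
  also have "\<dots> \<le> (\<Prod>i=1..Suc k. 1 - p ^ i) * (1 - y)"
    using Suc y by (intro mult_right_mono) (simp_all add: y_def)
  finally show ?case by (simp add: y_def)
qed

text \<open>The first two weights are kept exactly, and from the third on the product is replaced by
  \<open>1 - p - p^2\<close>, which leaves a geometric series.\<close>

lemma weight_sum_ge_1:
  assumes p: "0 \<le> p" "p \<le> 1" and t: "t = real d * p" "t < 1"
    and ge: "(1 - t)\<^sup>2 \<le> t\<^sup>2 * (1 - p) * (1 - t) + t ^ 3 * (1 - p - p\<^sup>2)"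
  shows "1 \<le> weight_sum d p"
proof -
  let ?f = "\<lambda>k. weight d p (Suc k)"
  have sf: "summable ?f" using summable_weight p t by simp
  have t0: "0 \<le> t" using p t by simp
  have gs: "(\<lambda>k. t ^ 3 * (1 - p - p\<^sup>2) * t ^ k) sums (t ^ 3 * (1 - p - p\<^sup>2) * (1 / (1 - t)))"
    using t t0 by (intro sums_mult geometric_sums) simp
  have "t ^ 3 * (1 - p - p\<^sup>2) * t ^ k \<le> ?f (k + 2)" for k
  proof -
    have "1 - p - p\<^sup>2 \<le> (\<Prod>i=1..Suc (Suc k). 1 - p ^ i)"
      using prod_one_minus_power_ge[OF p, of "Suc k"] p by (smt (verit) zero_le_power)
    then have "t ^ (k + 3) * (1 - p - p\<^sup>2) \<le> t ^ (k + 3) * (\<Prod>i=1..Suc (Suc k). 1 - p ^ i)"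
      using t0 by (intro mult_left_mono) auto
    also have "\<dots> = ?f (k + 2)"
      by (simp add: weight_def t(1) numeral_3_eq_3 del: prod.cl_ivl_Suc)
    finally show ?thesis by (simp add: power_add mult_ac)
  qed
  then have "t ^ 3 * (1 - p - p\<^sup>2) * (1 / (1 - t)) \<le> (\<Sum>k. ?f (k + 2))"
    using suminf_le[OF _ sums_summable[OF gs], of "\<lambda>k. ?f (k + 2)"] summable_ignore_initial_segment[OF sf, of 2]
    unfolding sums_unique[OF gs] by blast
  moreover have "weight_sum d p = (\<Sum>k. ?f (k + 2)) + (t + t\<^sup>2 * (1 - p))"
    unfolding weight_sum_def using suminf_split_initial_segment[OF sf, of 2]
    by (simp add: weight_def t(1) numeral_2_eq_2)
  moreover have "(1 - t - t\<^sup>2 * (1 - p)) * (1 - t) \<le> t ^ 3 * (1 - p - p\<^sup>2)"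
    using ge by (simp add: power2_eq_square algebra_simps)
  then have "1 - t - t\<^sup>2 * (1 - p) \<le> t ^ 3 * (1 - p - p\<^sup>2) * (1 / (1 - t))"
    using t(2) by (simp add: pos_le_divide_eq)
  ultimately show ?thesis by linarith
qed

lemma partial_weight_le:
  assumes "0 \<le> p" "p \<le> 1" "real d * p < 1" "weight_sum d p \<le> 1"
  shows "(\<Sum>k<n. weight d p (Suc k)) \<le> 1"
  using sum_le_suminf[OF summable_weight[OF assms(1-3)], of "{..<n}"] weight_nonneg[of p d] assms
  unfolding weight_sum_def by force

text \<open>Two polynomial tests suffice. The order \<open>l \<le> u\<close> is not assumed: it
  follows from the two bounds, and then a solution exists between them.\<close>

lemma pc_cp_enclosure:
  assumes d: "2 \<le> d" and l: "0 < l" "real d * l < 1" "(real d * l)\<^sup>2 * (1 - l) \<le> (1 - real d * l)\<^sup>2"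
    and u: "0 < u" "real d * u < 1"
      "(1 - real d * u)\<^sup>2 \<le> (real d * u)\<^sup>2 * (1 - u) * (1 - real d * u) + (real d * u) ^ 3 * (1 - u - u\<^sup>2)"
  shows "l \<le> pc_cp d \<and> pc_cp d \<le> u \<and>
    0 < pc_cp d \<and> pc_cp d < 1 \<and> (\<lambda>k. weight d (pc_cp d) (Suc k)) sums 1"
proof -
  have half: "x < 1 / 2" if "0 < x" "real d * x < 1" for x
  proof -
    have "2 * x \<le> real d * x" using d that by simp
    then show ?thesis using that by linarith
  qed
  have L: "weight_sum d l \<le> 1" using l half[of l] by (intro weight_sum_le_1) auto
  have U: "1 \<le> weight_sum d u" using u half[of u] by (intro weight_sum_ge_1) auto
  have up: "pc_cp d \<le> u" "percolating d \<noteq> {}"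
    using pc_cp_le[of d u] d u half[of u] U by auto
  have lo: "l \<le> pc_cp d"
    using l half[of l] d L up(2) by (intro pc_cp_ge partial_weight_le) auto
  show ?thesis using pc_cp_sums[OF d l(1) _ u(2) L U] lo up by simp
qed

lemma pc_cp_enclosure_2:
  "266667 / 1000000 \<le> pc_cp 2 \<and> pc_cp 2 \<le> 277206 / 1000000 \<and>
    0 < pc_cp 2 \<and> pc_cp 2 < 1 \<and> (\<lambda>k. weight 2 (pc_cp 2) (Suc k)) sums 1"
  by (rule pc_cp_enclosure) (simp_all add: power2_eq_square power3_eq_cube)

lemma pc_cp_enclosure_ge_3:
  assumes d: "3 \<le> d"
  defines "u \<equiv> (7 * real d - 1) * (1 - sqrt (1 - 14 / (7 * real d - 1)\<^sup>2)) / 2"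
  shows "1 / (2 * real d - 1 / 4) \<le> pc_cp d \<and> pc_cp d \<le> u \<and>
    0 < pc_cp d \<and> pc_cp d < 1 \<and> (\<lambda>k. weight d (pc_cp d) (Suc k)) sums 1"
proof (rule pc_cp_enclosure)
  show "2 \<le> d" using d by simp
  define l where "l = 1 / (2 * real d - 1 / 4)"
  have l: "0 < l" "l \<le> 1 / 5" using d by (auto simp: l_def divide_le_eq)
  have tl: "real d * l = 1 / 2 + l / 8"
    using d by (simp add: l_def field_simps)
  show "0 < 1 / (2 * real d - 1 / 4)" "real d * (1 / (2 * real d - 1 / 4)) < 1"
    using l tl unfolding l_def[symmetric] by simp_all
  \<comment> \<open>The difference of the two sides is \<open>8 * l^2 + l^3\<close>.\<close>
  have "(4 + l)\<^sup>2 * (1 - l) \<le> (4 - l)\<^sup>2"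
    using l by (simp add: power2_eq_square algebra_simps)
  then show "(real d * (1 / (2 * real d - 1 / 4)))\<^sup>2 * (1 - 1 / (2 * real d - 1 / 4))
      \<le> (1 - real d * (1 / (2 * real d - 1 / 4)))\<^sup>2"
    unfolding l_def[symmetric] tl by (simp add: power2_eq_square field_simps)
next
  define a where "a = 7 * real d - 1"
  define s where "s = sqrt (1 - 14 / a\<^sup>2)"
  have a: "20 \<le> a" using d by (simp add: a_def)
  have u: "u = a * (1 - s) / 2" by (simp add: u_def a_def s_def)
  have "14 < a\<^sup>2" using a mult_mono[of 20 a 20 a] by (simp add: power2_eq_square)
  then have s2: "s\<^sup>2 = 1 - 14 / a\<^sup>2" and s1: "s < 1"
    using a by (simp_all add: s_def)
  \<comment> \<open>\<open>u\<close> is the smaller root of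
    \<open>x^2 - a * x + 7 / 2\<close>.\<close>
  have root: "7 * (real d * u) = u\<^sup>2 + u + 7 / 2"
  proof -
    have "a\<^sup>2 * s\<^sup>2 = a\<^sup>2 - 14" using a by (simp add: s2 field_simps)
    then have "u\<^sup>2 - a * u + 7 / 2 = 0"
      by (simp add: u power2_eq_square field_simps)
    then show ?thesis by (simp add: a_def algebra_simps)
  qed
  \<comment> \<open>This amounts to \<open>0.72 * a \<ge> 14.1296\<close>, which
    \<open>a \<ge> 20\<close> ensures; it yields \<open>u \<le> 0.18\<close>.\<close>
  have "(1 - (36 / 100) / a)\<^sup>2 \<le> 1 - 14 / a\<^sup>2"
    using a by (simp add: power2_eq_square field_simps)
  then have "1 - (36 / 100) / a \<le> s" unfolding s_def by (rule real_le_rsqrt)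
  then have "a * (1 - s) \<le> 36 / 100" using a by (simp add: field_simps)
  then have u18: "u \<le> 18 / 100" by (simp add: u)
  show u0: "0 < u" using a s1 by (simp add: u)
  define x where "x = u + u\<^sup>2"
  have "u\<^sup>2 \<le> (18 / 100)\<^sup>2" using u0 u18 by (intro power_mono) auto
  then have x: "0 < x" "x \<le> 24 / 100" using u0 u18 by (auto simp: x_def power2_eq_square add_pos_nonneg)
  have t: "real d * u = (7 + 2 * x) / 14" using root by (simp add: x_def)
  then show t1: "real d * u < 1" using x by simp
  \<comment> \<open>\<open>(7 - 2 * x)^2\<close> equals \<open>(7 + 2 * x)^2 - 56 * x\<close>, and
    \<open>24 / 100\<close> is small enough for \<open>(7 + 2 * x)^2 \<le> 56\<close>.\<close>
  have "(7 + 2 * x)\<^sup>2 \<le> (7 + 2 * (24 / 100))\<^sup>2" using x by (intro power_mono) auto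
  then have "x * (7 + 2 * x)\<^sup>2 \<le> x * 56" using x by (intro mult_left_mono) (auto simp: power2_eq_square)
  then have "(7 - 2 * x)\<^sup>2 \<le> (7 + 2 * x)\<^sup>2 * (1 - x)"
    by (simp add: power2_eq_square algebra_simps)
  then have "(1 - real d * u)\<^sup>2 \<le> (real d * u)\<^sup>2 * (1 - x)"
    unfolding t by (simp add: power2_eq_square field_simps)
  \<comment> \<open>With \<open>1 - x\<close> for every product, the second weight and the tail
    merge; the second weight then gets back its true factor \<open>1 - u\<close>.\<close>
  also have "\<dots> = (real d * u)\<^sup>2 * (1 - x) * (1 - real d * u) + (real d * u) ^ 3 * (1 - u - u\<^sup>2)"
    by (simp add: x_def power2_eq_square power3_eq_cube algebra_simps)
  also have "\<dots> \<le> (real d * u)\<^sup>2 * (1 - u) * (1 - real d * u) + (real d * u) ^ 3 * (1 - u - u\<^sup>2)"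
    using t1 by (intro add_right_mono mult_right_mono mult_left_mono) (auto simp: x_def)
  finally show "(1 - real d * u)\<^sup>2 \<le>
    (real d * u)\<^sup>2 * (1 - u) * (1 - real d * u) + (real d * u) ^ 3 * (1 - u - u\<^sup>2)" .
qed

theorem proposition3p1:
  shows "(\<forall>d::nat. d \<ge> 2 \<longrightarrow>
            (\<forall>q::real. (0 < q \<and> q < 1 \<and>
                ((\<lambda>k::nat. (real d * q) ^ k * (\<Prod>i = 1..k - 1. 1 - q ^ i)) has_sum 1) {1..})
              \<longleftrightarrow> q = pc_cp d))
       \<and> 0.266667 \<le> pc_cp 2 \<and> pc_cp 2 \<le> 0.277206
       \<and> (\<forall>d::nat. d \<ge> 3 \<longrightarrow>
            1 / (2 * real d - 1 / 4) \<le> pc_cp d \<and>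
            pc_cp d \<le> (7 * real d - 1) * (1 - sqrt (1 - 14 / (7 * real d - 1)\<^sup>2)) / 2)"
proof (intro conjI allI impI)
  fix d :: nat and q :: real
  assume d: "2 \<le> d"
  have sol: "0 < pc_cp d \<and> pc_cp d < 1 \<and> (\<lambda>k. weight d (pc_cp d) (Suc k)) sums 1"
    using pc_cp_enclosure_2 pc_cp_enclosure_ge_3[of d] d by (cases "d = 2") auto
  have fold: "(\<lambda>k. (real d * q) ^ k * (\<Prod>i = 1..k - 1. 1 - q ^ i)) = weight d q"
    by (simp only: weight_def[abs_def])
  have iff: "(weight d q has_sum 1) {1..} \<longleftrightarrow> (\<lambda>k. weight d q (Suc k)) sums 1" if "0 < q" "q < 1"
    using has_sum_weight_iff[of q d 1] that by simp
  show "(0 < q \<and> q < 1 \<and>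
      ((\<lambda>k::nat. (real d * q) ^ k * (\<Prod>i = 1..k - 1. 1 - q ^ i)) has_sum 1) {1..})
    \<longleftrightarrow> q = pc_cp d"
    unfolding fold using sol iff pc_cp_unique[OF d, of q] by blast
qed (use pc_cp_enclosure_2 pc_cp_enclosure_ge_3 in simp_all)

end
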